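(* Let $(\widetilde M,\widetilde g,\widetilde P)$ be an almost product Riemannian manifold, $(\overline M,\overline g)$ a submanifold of codimension 1 isometrically immersed in $\widetilde M$ with unit normal $N_2$, and $(M,g)$ a submanifold of codimension 1 isometrically immersed in $\overline M$ with unit normal $N_1$ (in $\overline M$). Let $(\overline P,\overline g,u_2,\xi_2,a_{22})$ be the structure induced on $\overline M$ by $(\widetilde P,\widetilde g)$. Then this structure induces on $M$ the structure $(P,g,u_1,u_2,\xi_1,\xi_2^\top,(a_{\alpha\beta}))$, which has the following properties for all $X,Y\in\chi(M)$: (i) $P^2X=X-u_1(X)\xi_1-u_2(X)\xi_2^\top$; (ii) $u_1(PX)=-a_{11}u_1(X)-a_{12}u_2(X)$; (iii) $u_2(PX)=-a_{21}u_1(X)-a_{22}u_2(X)$; (iv) $u_1(\xi_1)=1-a_{11}^2-a_{12}^2$; (v) $u_2(\xi_1)=-a_{11}a_{12}-a_{12}a_{22}$; (vi) $u_1(\xi_2^\top)=-a_{11}a_{12}-a_{12}a_{22}$; (vii) $u_2(\xi_2^\top)=1-a_{12}^2-a_{22}^2$; (viii) $P\xi_1=-a_{11}\xi_1-a_{12}\xi_2^\top$; (ix) $P\xi_2^\top=-a_{12}\xi_1-a_{22}\xi_2^\top$; (x) $u_1(X)=g(X,\xi_1)$; (xi) $u_2(X)=g(X,\xi_2^\top)$; (xii) $g(PX,Y)=g(X,PY)$; (xiii) $g(PX,PY)=g(X,Y)-u_1(X)u_1(Y)-u_2(X)u_2(Y)$.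
   Context: An almost product Riemannian manifold $(\widetilde M,\widetilde g,\widetilde P)$ is a Riemannian manifold with a $(1,1)$-tensor field $\widetilde P$ such that $\widetilde P^2=I$ and $\widetilde g(\widetilde PU,\widetilde PV)=\widetilde g(U,V)$ for all vector fields $U,V$. The structure on $\overline M$ is defined by the decompositions into components tangent and normal to $\overline M$ in $\widetilde M$: $$\widetilde P\,\overline X=\overline P\,\overline X+u_2(\overline X)N_2\ (\overline X\in\chi(\overline M)),\qquad \widetilde PN_2=\xi_2+a_{22}N_2,$$ with $\overline P$ a $(1,1)$-tensor field, $u_2$ a 1-form, $\xi_2$ a vector field and $a_{22}$ a function on $\overline M$. The objects $P,u_1,\xi_1,a_{11}$ on $M$ are defined by the decompositions into components tangent and normal to $M$ in $\overline M$: $$\overline PX=PX+u_1(X)N_1\ (X\in\chi(M)),\qquad \overline PN_1=\xi_1+a_{11}N_1,$$ with $P$ a $(1,1)$-tensor field, $u_1$ a 1-form, $\xi_1$ a tangent vector field and $a_{11}$ a function on $M$. Along $M$, $\xi_2=\xi_2^\top+\xi_2^\bot$ with $\xi_2^\top$ tangent to $M$ and $\xi_2^\bot$ normal to $M$ in $\overline M$ (collinear with $N_1$). Finally $a_{12}=a_{21}:=\widetilde g(\xi_2^\bot,N_1)$, and $u_2$, $a_{22}$ also denote their restrictions to $M$; $(a_{\alpha\beta})$, $\alpha,\beta\in\{1,2\}$, is the resulting $2\times2$ matrix of functions on $M$. *)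

theory Defs
  imports "HOL-Analysis.Analysis" "HOL-Library.Function_Algebras"
begin

primrec Ck_on :: "nat \<Rightarrow> ('a::euclidean_space \<Rightarrow> 'b::real_normed_vector) \<Rightarrow> 'a set \<Rightarrow> bool" where
  "Ck_on 0 f S \<longleftrightarrow> continuous_on S f"
| "Ck_on (Suc k) f S \<longleftrightarrow> f differentiable_on S \<and>
     (\<forall>e. Ck_on k (\<lambda>x. frechet_derivative f (at x) e) S)"

text \<open>Only meant for open \<open>S\<close>.\<close>

definition smooth_on :: "('a::euclidean_space \<Rightarrow> 'b::real_normed_vector) \<Rightarrow> 'a set \<Rightarrow> bool" where
  "smooth_on f S \<longleftrightarrow> (\<forall>k. Ck_on k f S)"

text \<open>A manifold is a topological space with a smooth atlas; its dimension is that of the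
  Euclidean model space \<open>'e\<close>. A chart is a pair of its domain and its coordinate map; the values
  of the coordinate map outside the domain are irrelevant. The atlas need not be maximal.\<close>

type_synonym ('a, 'e) chart = "'a set \<times> ('a \<Rightarrow> 'e)"

record ('a, 'e) manifold =
  mtop :: "'a topology"
  atlas :: "('a, 'e) chart set"

abbreviation points :: "('a, 'e) manifold \<Rightarrow> 'a set" where
  "points M \<equiv> topspace (mtop M)"

definition chart_inv :: "('a, 'e) chart \<Rightarrow> 'e \<Rightarrow> 'a" where
  "chart_inv c = inv_into (fst c) (snd c)"

definition smooth_manifold :: "('a, 'e::euclidean_space) manifold \<Rightarrow> bool" where
  "smooth_manifold M \<longleftrightarrow>
     Hausdorff_space (mtop M) \<and> second_countable (mtop M) \<and>
     (\<Union>c\<in>atlas M. fst c) = points M \<and>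
     (\<forall>c\<in>atlas M. openin (mtop M) (fst c) \<and> open (snd c ` fst c) \<and>
        homeomorphic_map (subtopology (mtop M) (fst c)) (top_of_set (snd c ` fst c)) (snd c)) \<and>
     (\<forall>c\<in>atlas M. \<forall>d\<in>atlas M. smooth_on (snd d \<circ> chart_inv c) (snd c ` (fst c \<inter> fst d)))"

definition charts_at :: "('a, 'e) manifold \<Rightarrow> 'a \<Rightarrow> ('a, 'e) chart set" where
  "charts_at M p = {c \<in> atlas M. p \<in> fst c}"

definition smooth_fun :: "('a, 'e::euclidean_space) manifold \<Rightarrow> ('a \<Rightarrow> real) \<Rightarrow> bool" where
  "smooth_fun M h \<longleftrightarrow> (\<forall>c\<in>atlas M. smooth_on (h \<circ> chart_inv c) (snd c ` fst c))"

definition smooth_map ::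
    "('a, 'e::euclidean_space) manifold \<Rightarrow> ('b, 'f::euclidean_space) manifold \<Rightarrow> ('a \<Rightarrow> 'b) \<Rightarrow> bool" where
  "smooth_map M N f \<longleftrightarrow> continuous_map (mtop M) (mtop N) f \<and>
     (\<forall>c\<in>atlas M. \<forall>d\<in>atlas N.
        smooth_on (snd d \<circ> f \<circ> chart_inv c) (snd c ` (fst c \<inter> f -` fst d)))"

text \<open>A tangent vector at \<open>p\<close> is the family of its coordinate vectors in all charts around \<open>p\<close>,
  related by the derivatives of the coordinate changes (and \<open>0\<close> at every other index). The vector
  space operations are the pointwise ones on functions.\<close>

instantiation "fun" :: (type, real_vector) real_vector
begin

definition scaleR_fun :: "real \<Rightarrow> ('a \<Rightarrow> 'b) \<Rightarrow> 'a \<Rightarrow> 'b" where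
  "scaleR_fun r f = (\<lambda>x. r *\<^sub>R f x)"

instance
  by standard (auto simp: scaleR_fun_def fun_eq_iff algebra_simps)

end

type_synonym ('a, 'e) tvec = "('a, 'e) chart \<Rightarrow> 'e"

definition transition_deriv ::
    "('a, 'e::euclidean_space) chart \<Rightarrow> ('a, 'e) chart \<Rightarrow> 'a \<Rightarrow> 'e \<Rightarrow> 'e" where
  "transition_deriv c d p = frechet_derivative (snd d \<circ> chart_inv c) (at (snd c p))"

definition tangent_space :: "('a, 'e::euclidean_space) manifold \<Rightarrow> 'a \<Rightarrow> ('a, 'e) tvec set" where
  "tangent_space M p = {v. (\<forall>c. c \<notin> charts_at M p \<longrightarrow> v c = 0) \<and>
     (\<forall>c\<in>charts_at M p. \<forall>d\<in>charts_at M p. v d = transition_deriv c d p (v c))}"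

text \<open>The tangent vector at \<open>p\<close> with coordinates \<open>e\<close> in the chart \<open>c\<close>; for \<open>e\<close> in the standard
  basis these are the coordinate fields of \<open>c\<close>.\<close>

definition coord_vec ::
    "('a, 'e::euclidean_space) manifold \<Rightarrow> ('a, 'e) chart \<Rightarrow> 'e \<Rightarrow> 'a \<Rightarrow> ('a, 'e) tvec" where
  "coord_vec M c e p = (\<lambda>d. if d \<in> charts_at M p then transition_deriv c d p e else 0)"

text \<open>The differential of \<open>f\<close> at \<open>p\<close>, computed in some chart around \<open>p\<close>; by the chain rule the
  choice does not matter on tangent vectors.\<close>

definition differential ::
    "('a, 'e::euclidean_space) manifold \<Rightarrow> ('b, 'f::euclidean_space) manifold \<Rightarrow> ('a \<Rightarrow> 'b) \<Rightarrow>
     'a \<Rightarrow> ('a, 'e) tvec \<Rightarrow> ('b, 'f) tvec" where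
  "differential M N f p v = (\<lambda>d. if d \<in> charts_at N (f p)
     then let c = (SOME c. c \<in> charts_at M p)
          in frechet_derivative (snd d \<circ> f \<circ> chart_inv c) (at (snd c p)) (v c)
     else 0)"

text \<open>Tensor fields are families of multilinear maps on the tangent spaces (their values off the
  tangent spaces are irrelevant) whose components with respect to the coordinate fields of every
  chart are smooth. Identities between tensor fields are identities on every tangent space.\<close>

definition linear_on_subspace :: "'v::real_vector set \<Rightarrow> ('v \<Rightarrow> 'w::real_vector) \<Rightarrow> bool" where
  "linear_on_subspace V L \<longleftrightarrow>
     (\<forall>v\<in>V. \<forall>w\<in>V. L (v + w) = L v + L w) \<and> (\<forall>r. \<forall>v\<in>V. L (r *\<^sub>R v) = r *\<^sub>R L v)"

definition vector_fields :: "('a, 'e::euclidean_space) manifold \<Rightarrow> ('a \<Rightarrow> ('a, 'e) tvec) set" where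
  "vector_fields M = {X. (\<forall>p\<in>points M. X p \<in> tangent_space M p) \<and>
     (\<forall>c\<in>atlas M. smooth_on (\<lambda>x. X (chart_inv c x) c) (snd c ` fst c))}"

definition vector_fields_along ::
    "('a, 'e::euclidean_space) manifold \<Rightarrow> ('b, 'f::euclidean_space) manifold \<Rightarrow> ('a \<Rightarrow> 'b) \<Rightarrow>
     ('a \<Rightarrow> ('b, 'f) tvec) set" where
  "vector_fields_along M N f = {W. (\<forall>p\<in>points M. W p \<in> tangent_space N (f p)) \<and>
     (\<forall>c\<in>atlas M. \<forall>d\<in>atlas N.
        smooth_on (\<lambda>x. W (chart_inv c x) d) (snd c ` (fst c \<inter> f -` fst d)))}"

definition one_form ::
    "('a, 'e::euclidean_space) manifold \<Rightarrow> ('a \<Rightarrow> ('a, 'e) tvec \<Rightarrow> real) \<Rightarrow> bool" where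
  "one_form M u \<longleftrightarrow>
     (\<forall>p\<in>points M. linear_on_subspace (tangent_space M p) (u p)) \<and>
     (\<forall>c\<in>atlas M. \<forall>e. smooth_on
        (\<lambda>x. u (chart_inv c x) (coord_vec M c e (chart_inv c x))) (snd c ` fst c))"

definition tensor_field_1_1 ::
    "('a, 'e::euclidean_space) manifold \<Rightarrow> ('a \<Rightarrow> ('a, 'e) tvec \<Rightarrow> ('a, 'e) tvec) \<Rightarrow> bool" where
  "tensor_field_1_1 M P \<longleftrightarrow>
     (\<forall>p\<in>points M. P p ` tangent_space M p \<subseteq> tangent_space M p \<and>
        linear_on_subspace (tangent_space M p) (P p)) \<and>
     (\<forall>c\<in>atlas M. \<forall>e. smooth_on
        (\<lambda>x. P (chart_inv c x) (coord_vec M c e (chart_inv c x)) c) (snd c ` fst c))"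

type_synonym ('a, 'e) metric = "'a \<Rightarrow> ('a, 'e) tvec \<Rightarrow> ('a, 'e) tvec \<Rightarrow> real"

definition riemannian_metric ::
    "('a, 'e::euclidean_space) manifold \<Rightarrow> ('a, 'e) metric \<Rightarrow> bool" where
  "riemannian_metric M g \<longleftrightarrow>
     (\<forall>p\<in>points M. \<forall>v\<in>tangent_space M p.
        linear_on_subspace (tangent_space M p) (g p v) \<and>
        (\<forall>w\<in>tangent_space M p. g p v w = g p w v) \<and>
        (v \<noteq> 0 \<longrightarrow> g p v v > 0)) \<and>
     (\<forall>c\<in>atlas M. \<forall>e e'. smooth_on
        (\<lambda>x. g (chart_inv c x) (coord_vec M c e (chart_inv c x)) (coord_vec M c e' (chart_inv c x)))
        (snd c ` fst c))"

definition riemannian_manifold ::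
    "('a, 'e::euclidean_space) manifold \<Rightarrow> ('a, 'e) metric \<Rightarrow> bool" where
  "riemannian_manifold M g \<longleftrightarrow> smooth_manifold M \<and> riemannian_metric M g"

definition almost_product_riemannian ::
    "('a, 'e::euclidean_space) manifold \<Rightarrow> ('a, 'e) metric \<Rightarrow>
     ('a \<Rightarrow> ('a, 'e) tvec \<Rightarrow> ('a, 'e) tvec) \<Rightarrow> bool" where
  "almost_product_riemannian M g P \<longleftrightarrow>
     riemannian_manifold M g \<and> tensor_field_1_1 M P \<and>
     (\<forall>p\<in>points M. \<forall>U\<in>tangent_space M p. P p (P p U) = U) \<and>
     (\<forall>p\<in>points M. \<forall>U\<in>tangent_space M p. \<forall>V\<in>tangent_space M p.
        g p (P p U) (P p V) = g p U V)"

definition isometric_immersion ::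
    "('a, 'e::euclidean_space) manifold \<Rightarrow> ('a, 'e) metric \<Rightarrow>
     ('b, 'f::euclidean_space) manifold \<Rightarrow> ('b, 'f) metric \<Rightarrow> ('a \<Rightarrow> 'b) \<Rightarrow> bool" where
  "isometric_immersion M g N h f \<longleftrightarrow>
     smooth_map M N f \<and>
     (\<forall>p\<in>points M. inj_on (differential M N f p) (tangent_space M p)) \<and>
     (\<forall>p\<in>points M. \<forall>v\<in>tangent_space M p. \<forall>w\<in>tangent_space M p.
        h (f p) (differential M N f p v) (differential M N f p w) = g p v w)"

definition normal_space ::
    "('a, 'e::euclidean_space) manifold \<Rightarrow> ('b, 'f::euclidean_space) manifold \<Rightarrow> ('b, 'f) metric \<Rightarrow>
     ('a \<Rightarrow> 'b) \<Rightarrow> 'a \<Rightarrow> ('b, 'f) tvec set" where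
  "normal_space M N h f p = {w \<in> tangent_space N (f p).
     \<forall>v\<in>tangent_space M p. h (f p) (differential M N f p v) w = 0}"

definition unit_normal_field ::
    "('a, 'e::euclidean_space) manifold \<Rightarrow> ('b, 'f::euclidean_space) manifold \<Rightarrow> ('b, 'f) metric \<Rightarrow>
     ('a \<Rightarrow> 'b) \<Rightarrow> ('a \<Rightarrow> ('b, 'f) tvec) \<Rightarrow> bool" where
  "unit_normal_field M N h f \<nu> \<longleftrightarrow>
     \<nu> \<in> vector_fields_along M N f \<and>
     (\<forall>p\<in>points M. \<nu> p \<in> normal_space M N h f p \<and> h (f p) (\<nu> p) (\<nu> p) = 1)"

text \<open>The structure \<open>(P, u, \<xi>, a)\<close> obtained on a hypersurface \<open>f : M \<rightarrow> N\<close> by splitting a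
  \<open>(1,1)\<close>-tensor field \<open>Q\<close> of the ambient manifold \<open>N\<close> into components tangent and normal
  to \<open>M\<close>.\<close>

definition hypersurface_decomposition ::
    "('a, 'e::euclidean_space) manifold \<Rightarrow> ('b, 'f::euclidean_space) manifold \<Rightarrow> ('a \<Rightarrow> 'b) \<Rightarrow>
     ('a \<Rightarrow> ('b, 'f) tvec) \<Rightarrow> ('b \<Rightarrow> ('b, 'f) tvec \<Rightarrow> ('b, 'f) tvec) \<Rightarrow>
     ('a \<Rightarrow> ('a, 'e) tvec \<Rightarrow> ('a, 'e) tvec) \<Rightarrow> ('a \<Rightarrow> ('a, 'e) tvec \<Rightarrow> real) \<Rightarrow>
     ('a \<Rightarrow> ('a, 'e) tvec) \<Rightarrow> ('a \<Rightarrow> real) \<Rightarrow> bool" where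
  "hypersurface_decomposition M N f \<nu> Q P u \<xi> a \<longleftrightarrow>
     tensor_field_1_1 M P \<and> one_form M u \<and> \<xi> \<in> vector_fields M \<and> smooth_fun M a \<and>
     (\<forall>p\<in>points M. \<forall>X\<in>tangent_space M p.
        Q (f p) (differential M N f p X) = differential M N f p (P p X) + u p X *\<^sub>R \<nu> p) \<and>
     (\<forall>p\<in>points M. Q (f p) (\<nu> p) = differential M N f p (\<xi> p) + a p *\<^sub>R \<nu> p)"

text \<open>The structure induced on \<open>M\<close>, immersed by \<open>f\<close> into \<open>M'\<close>, which is itself immersed by
  \<open>f'\<close> into \<open>(M'', g'')\<close>. Here \<open>P'\<close>, \<open>u2'\<close>, \<open>\<xi>2'\<close>, \<open>a22'\<close> live on \<open>M'\<close>; \<open>u2\<close> and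
  \<open>a $ 2 $ 2\<close> are the restrictions of \<open>u2'\<close> and \<open>a22'\<close> to \<open>M\<close>, and \<open>\<xi>2T\<close> is the tangential
  part of \<open>\<xi>2'\<close> along \<open>M\<close>.\<close>

definition induced_structure ::
    "('a, 'e::euclidean_space) manifold \<Rightarrow>
     ('b, 'f::euclidean_space) manifold \<Rightarrow> ('b, 'f) metric \<Rightarrow>
     ('c, 'h::euclidean_space) manifold \<Rightarrow> ('c, 'h) metric \<Rightarrow>
     ('a \<Rightarrow> 'b) \<Rightarrow> ('b \<Rightarrow> 'c) \<Rightarrow> ('a \<Rightarrow> ('b, 'f) tvec) \<Rightarrow>
     ('b \<Rightarrow> ('b, 'f) tvec \<Rightarrow> ('b, 'f) tvec) \<Rightarrow> ('b \<Rightarrow> ('b, 'f) tvec \<Rightarrow> real) \<Rightarrow>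
     ('b \<Rightarrow> ('b, 'f) tvec) \<Rightarrow> ('b \<Rightarrow> real) \<Rightarrow>
     ('a \<Rightarrow> ('a, 'e) tvec \<Rightarrow> ('a, 'e) tvec) \<Rightarrow>
     ('a \<Rightarrow> ('a, 'e) tvec \<Rightarrow> real) \<Rightarrow> ('a \<Rightarrow> ('a, 'e) tvec \<Rightarrow> real) \<Rightarrow>
     ('a \<Rightarrow> ('a, 'e) tvec) \<Rightarrow> ('a \<Rightarrow> ('a, 'e) tvec) \<Rightarrow> ('a \<Rightarrow> real^2^2) \<Rightarrow> bool" where
  "induced_structure M M' g' M'' g'' f f' N1 P' u2' \<xi>2' a22' P u1 u2 \<xi>1 \<xi>2T a \<longleftrightarrow>
     hypersurface_decomposition M M' f N1 P' P u1 \<xi>1 (\<lambda>p. a p $ 1 $ 1) \<and>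
     one_form M u2 \<and> (\<forall>p\<in>points M. \<forall>X\<in>tangent_space M p.
        u2 p X = u2' (f p) (differential M M' f p X)) \<and>
     \<xi>2T \<in> vector_fields M \<and>
     (\<forall>\<alpha> \<beta>. smooth_fun M (\<lambda>p. a p $ \<alpha> $ \<beta>)) \<and>
     (\<forall>p\<in>points M. a p $ 2 $ 2 = a22' (f p)) \<and>
     (\<forall>p\<in>points M. \<exists>\<zeta>\<in>normal_space M M' g' f p.
        \<xi>2' (f p) = differential M M' f p (\<xi>2T p) + \<zeta> \<and>
        a p $ 1 $ 2 =
          g'' (f' (f p)) (differential M' M'' f' (f p) \<zeta>) (differential M' M'' f' (f p) (N1 p))) \<and>
     (\<forall>p\<in>points M. a p $ 2 $ 1 = a p $ 1 $ 2)"

end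

theory Submission
  imports Defs
begin

text \<open>Tangentially and normally splitting \<open>Q (Q Z)\<close> along a hypersurface, and comparing with a known
  value of \<open>Q\<^sup>2\<close>, yields all the identities. If \<open>Q\<close> is self-adjoint and
  \<open>Q\<^sup>2 Z = Z - h Z \<eta> \<eta>\<close>, \<open>Q \<eta> = - b \<eta>\<close>, \<open>h \<eta> \<eta> = 1 - b\<^sup>2\<close>, the induced structure satisfies
  relations of the same shape with one more field \<open>\<xi>\<close>; the almost product structure is the case
  \<open>\<eta> = 0\<close>, \<open>b = 1\<close>, and \<open>\<eta> = \<xi>\<^sub>2\<close>, \<open>b = a\<^sub>2\<^sub>2\<close> is what the first step hands to the second.

  The induced objects are smooth because in charts the tangential and normal parts \<open>(v, \<alpha>)\<close> of \<open>w\<close> solve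
  the uniquely solvable linear system \<open>df v + \<alpha> \<nu> = w\<close>. The solution of such a system is as smooth as its
  data: its derivative solves the same system with a new right-hand side.\<close>

subsection \<open>Calculus of \<open>C\<^sup>k\<close> maps\<close>

text \<open>The pattern of hypotheses on \<open>\<eta>\<close> and \<open>b\<close> is produced by
  the algebra itself. For the almost product structure, comparing the tangential and normal parts of
  \<open>Q (Q \<nu>) = \<nu>\<close> on the first hypersurface gives
  \<open>P' \<xi>2' = - a22' \<xi>2'\<close> and \<open>u2' \<xi>2' = 1 - a22'\<^sup>2\<close>,
  where \<open>u2'\<close> is the metric product with \<open>\<xi>2'\<close>. So \<open>P'\<close>
  is in general neither an involution nor an isometry, but it stays self-adjoint and its square
  differs from the identity by a single rank one term. Self-adjointness is therefore the property
  handed down, and the metric identity for \<open>P\<close> is recovered from the formula for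
  \<open>P\<^sup>2\<close>. For \<open>\<eta> = 0\<close> the norm relation reads
  \<open>0 = 1 - b\<^sup>2\<close>, which leaves \<open>b = 1\<close> up to sign.

  The analytic obstacle is a circularity: the differentiated linear system contains the solution,
  about which nothing is known at first. Continuity comes from an estimate. A product rule for a
  merely continuous factor times a vanishing one then gives the first derivative.\<close>

lemma has_derivative_frechet_derivative_on:
  assumes "f differentiable_on S" "open S" "x \<in> S"
  shows "(f has_derivative frechet_derivative f (at x)) (at x)"
  using assms by (metis at_within_open differentiable_on_def frechet_derivative_works)

lemma Ck_on_SucI:
  fixes f :: "'a::euclidean_space \<Rightarrow> 'b::real_normed_vector"
  assumes "\<And>x. x \<in> S \<Longrightarrow> (f has_derivative D x) (at x)"
    and "\<And>e. Ck_on k (\<lambda>x. frechet_derivative f (at x) e) S"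
  shows "Ck_on (Suc k) f S"
  using assms by (auto simp: differentiable_on_def differentiable_def intro: has_derivative_at_withinI)

text \<open>A derivative at a point of an open set sees only the values on that set, so the
  derivatives of \<open>f\<close> and \<open>g\<close> coincide there. Chart representations agree
  only on such sets.\<close>

lemma Ck_on_cong:
  fixes f g :: "'a::euclidean_space \<Rightarrow> 'b::real_normed_vector"
  assumes "Ck_on k f S" "open S" "\<And>x. x \<in> S \<Longrightarrow> f x = g x"
  shows "Ck_on k g S"
  using assms
proof (induction k arbitrary: f g)
  case 0
  then show ?case by (simp cong: continuous_on_cong)
next
  case (Suc k)
  have g: "(g has_derivative frechet_derivative f (at x)) (at x)" if "x \<in> S" for x
    using has_derivative_transform_within_open[OF has_derivative_frechet_derivative_on[OF _ Suc.prems(2) that]]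
      Suc.prems that by auto
  then have "frechet_derivative f (at x) = frechet_derivative g (at x)" if "x \<in> S" for x
    using frechet_derivative_at that by blast
  then have "Ck_on k (\<lambda>x. frechet_derivative g (at x) e) S" for e
    using Suc.IH[of "\<lambda>x. frechet_derivative f (at x) e"] Suc.prems by simp
  then show ?case using Ck_on_SucI[OF g] by blast
qed

text \<open>A derivative at a point is unique, so \<open>frechet_derivative\<close> may be replaced
  on \<open>S\<close> by any explicit formula \<open>D\<close>. The closure properties below are
  inductions on \<open>k\<close> with such a formula.\<close>

lemma Ck_on_SucI':
  fixes f :: "'a::euclidean_space \<Rightarrow> 'b::real_normed_vector"
  assumes "open S" "\<And>x. x \<in> S \<Longrightarrow> (f has_derivative D x) (at x)"
    and "\<And>e. Ck_on k (\<lambda>x. D x e) S"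
  shows "Ck_on (Suc k) f S"
proof (rule Ck_on_SucI[OF assms(2)])
  show "Ck_on k (\<lambda>x. frechet_derivative f (at x) e) S" for e
    by (rule Ck_on_cong[OF assms(3)[of e] assms(1)]) (simp add: frechet_derivative_at[OF assms(2)])
qed

lemma Ck_on_SucD:
  fixes f :: "'a::euclidean_space \<Rightarrow> 'b::real_normed_vector"
  assumes "Ck_on (Suc k) f S"
  shows "open S \<Longrightarrow> x \<in> S \<Longrightarrow> (f has_derivative frechet_derivative f (at x)) (at x)"
    and "Ck_on k (\<lambda>x. frechet_derivative f (at x) e) S"
  using assms has_derivative_frechet_derivative_on by auto

lemma Ck_on_Suc_imp:
  fixes f :: "'a::euclidean_space \<Rightarrow> 'b::real_normed_vector"
  shows "Ck_on (Suc k) f S \<Longrightarrow> Ck_on k f S"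
proof (induction k arbitrary: f)
  case 0
  then show ?case by (auto intro: differentiable_imp_continuous_on)
next
  case (Suc k)
  have "Ck_on k (\<lambda>x. frechet_derivative f (at x) e) S" for e
    by (intro Suc.IH Ck_on_SucD(2)[OF Suc.prems])
  with Suc.prems show ?case by simp
qed

text \<open>Needed because a chart domain of the source is covered only by pieces that a map sends
  into one chart of the target.\<close>

lemma Ck_on_local:
  fixes f :: "'a::euclidean_space \<Rightarrow> 'b::real_normed_vector"
  assumes "\<And>x. x \<in> S \<Longrightarrow> \<exists>U. open U \<and> x \<in> U \<and> Ck_on k f U"
  shows "Ck_on k f S"
  using assms
proof (induction k arbitrary: f)
  case 0
  have "isCont f x" if "x \<in> S" for x
    using 0[OF that] continuous_on_eq_continuous_at by force
  then show ?case by (simp add: continuous_at_imp_continuous_on)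
next
  case (Suc k)
  have "(f has_derivative frechet_derivative f (at x)) (at x)" if "x \<in> S" for x
  proof -
    obtain U where "open U" "x \<in> U" "Ck_on (Suc k) f U" using Suc.prems \<open>x \<in> S\<close> by blast
    then show ?thesis by (intro Ck_on_SucD(1))
  qed
  moreover have "Ck_on k (\<lambda>x. frechet_derivative f (at x) e) S" for e
  proof (rule Suc.IH)
    fix x assume "x \<in> S"
    then obtain U where "open U" "x \<in> U" "Ck_on (Suc k) f U" using Suc.prems by blast
    then show "\<exists>U. open U \<and> x \<in> U \<and> Ck_on k (\<lambda>x. frechet_derivative f (at x) e) U"
      by (intro exI[of _ U] conjI Ck_on_SucD(2))
  qed
  ultimately show ?case by (rule Ck_on_SucI)
qed

lemma Ck_on_const:
  "open S \<Longrightarrow> Ck_on k (\<lambda>x::'a::euclidean_space. c::'b::real_normed_vector) S"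
proof (induction k arbitrary: c)
  case (Suc k)
  then show ?case by (intro Ck_on_SucI'[where D="\<lambda>x e. 0"]) auto
qed simp

lemma Ck_on_bounded_linear:
  fixes f :: "'a::euclidean_space \<Rightarrow> 'b::real_normed_vector"
  assumes "bounded_linear h" "open S" "Ck_on k f S"
  shows "Ck_on k (\<lambda>x. h (f x)) S"
  using assms(3)
proof (induction k arbitrary: f)
  case 0
  then show ?case
    using assms(1) by (auto intro: continuous_on_compose2[OF linear_continuous_on[of h UNIV]])
next
  case (Suc k)
  show ?case
  proof (rule Ck_on_SucI'[OF assms(2)])
    show "((\<lambda>x. h (f x)) has_derivative (\<lambda>e. h (frechet_derivative f (at x) e))) (at x)" if "x \<in> S" for x
      using bounded_linear.has_derivative[OF assms(1) Ck_on_SucD(1)[OF Suc.prems assms(2) that]] .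
    show "Ck_on k (\<lambda>x. h (frechet_derivative f (at x) e)) S" for e
      using Suc.IH Ck_on_SucD(2)[OF Suc.prems] .
  qed
qed

lemma Ck_on_add:
  fixes f g :: "'a::euclidean_space \<Rightarrow> 'b::real_normed_vector"
  assumes "open S" "Ck_on k f S" "Ck_on k g S"
  shows "Ck_on k (\<lambda>x. f x + g x) S"
  using assms(2,3)
proof (induction k arbitrary: f g)
  case 0
  then show ?case by (auto intro: continuous_on_add)
next
  case (Suc k)
  show ?case
  proof (rule Ck_on_SucI'[OF assms(1)])
    show "((\<lambda>x. f x + g x) has_derivative
        (\<lambda>e. frechet_derivative f (at x) e + frechet_derivative g (at x) e)) (at x)" if "x \<in> S" for x
      by (intro has_derivative_add Ck_on_SucD(1)[OF Suc.prems(1) assms(1) that]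
          Ck_on_SucD(1)[OF Suc.prems(2) assms(1) that])
    show "Ck_on k (\<lambda>x. frechet_derivative f (at x) e + frechet_derivative g (at x) e) S" for e
      by (intro Suc.IH Ck_on_SucD(2)[OF Suc.prems(1)] Ck_on_SucD(2)[OF Suc.prems(2)])
  qed
qed

lemma Ck_on_sum:
  fixes f :: "'i \<Rightarrow> 'a::euclidean_space \<Rightarrow> 'b::real_normed_vector"
  assumes "open S" "\<And>i. i \<in> I \<Longrightarrow> Ck_on k (f i) S"
  shows "Ck_on k (\<lambda>x. \<Sum>i\<in>I. f i x) S"
  using assms(2)
  by (induction I rule: infinite_finite_induct) (auto simp: Ck_on_const Ck_on_add assms(1))

lemma Ck_on_scaleR:
  fixes c :: "'a::euclidean_space \<Rightarrow> real" and f :: "'a \<Rightarrow> 'b::real_normed_vector"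
  assumes "open S" "Ck_on k c S" "Ck_on k f S"
  shows "Ck_on k (\<lambda>x. c x *\<^sub>R f x) S"
  using assms(2,3)
proof (induction k arbitrary: c f)
  case 0
  then show ?case by (auto intro: continuous_on_scaleR)
next
  case (Suc k)
  show ?case
  proof (rule Ck_on_SucI'[OF assms(1)])
    show "((\<lambda>x. c x *\<^sub>R f x) has_derivative
        (\<lambda>e. c x *\<^sub>R frechet_derivative f (at x) e + frechet_derivative c (at x) e *\<^sub>R f x)) (at x)"
      if "x \<in> S" for x
      by (intro has_derivative_scaleR Ck_on_SucD(1)[OF Suc.prems(1) assms(1) that]
          Ck_on_SucD(1)[OF Suc.prems(2) assms(1) that])
    show "Ck_on k (\<lambda>x. c x *\<^sub>R frechet_derivative f (at x) e + frechet_derivative c (at x) e *\<^sub>R f x) S" for e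
      by (intro Ck_on_add[OF assms(1)] Suc.IH Ck_on_SucD(2)[OF Suc.prems(1)]
          Ck_on_SucD(2)[OF Suc.prems(2)] Ck_on_Suc_imp[OF Suc.prems(1)] Ck_on_Suc_imp[OF Suc.prems(2)])
  qed
qed

lemma linear_eq_sum_Basis:
  fixes L :: "'p::euclidean_space \<Rightarrow> 'b::real_vector"
  assumes "linear L"
  shows "L v = (\<Sum>i\<in>Basis. (v \<bullet> i) *\<^sub>R L i)"
proof -
  have "L v = L (\<Sum>i\<in>Basis. (v \<bullet> i) *\<^sub>R i)" by (simp add: euclidean_representation)
  then show ?thesis by (simp only: linear_sum[OF assms] linear_scale[OF assms])
qed

text \<open>Expanding \<open>v x\<close> in the basis turns \<open>L x (v x)\<close> into a finite
  sum of products. Regularity of \<open>L\<close> at each fixed vector is then enough, and no norm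
  on a space of linear maps is required.\<close>

lemma Ck_on_linear_apply:
  fixes L :: "'a::euclidean_space \<Rightarrow> 'p::euclidean_space \<Rightarrow> 'b::real_normed_vector"
  assumes "open S" "\<And>x. x \<in> S \<Longrightarrow> linear (L x)" "\<And>e. Ck_on k (\<lambda>x. L x e) S" "Ck_on k v S"
  shows "Ck_on k (\<lambda>x. L x (v x)) S"
proof (rule Ck_on_cong[OF _ assms(1)])
  show "Ck_on k (\<lambda>x. \<Sum>i\<in>Basis. (v x \<bullet> i) *\<^sub>R L x i) S"
    by (intro Ck_on_sum Ck_on_scaleR assms(1,3)
        Ck_on_bounded_linear[OF bounded_linear_inner_left assms(1,4)])
qed (simp add: linear_eq_sum_Basis[OF assms(2), symmetric])

text \<open>By the chain rule the derivative is the linear family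
  \<open>frechet_derivative g (at (f x))\<close> applied to the derivative of \<open>f\<close>. At a
  fixed vector this family is again a composition with \<open>f\<close>, so the induction hypothesis
  covers it.\<close>

lemma Ck_on_compose:
  fixes f :: "'a::euclidean_space \<Rightarrow> 'b::euclidean_space" and g :: "'b \<Rightarrow> 'c::real_normed_vector"
  assumes "open S" "open T" "f ` S \<subseteq> T" "Ck_on k f S" "Ck_on k g T"
  shows "Ck_on k (\<lambda>x. g (f x)) S"
  using assms(4,5)
proof (induction k arbitrary: g)
  case 0
  then show ?case using assms(3) by (auto intro: continuous_on_compose2)
next
  case (Suc k)
  have T: "f x \<in> T" if "x \<in> S" for x using assms(3) that by auto
  have dg: "(g has_derivative frechet_derivative g (at (f x))) (at (f x))" if "x \<in> S" for x
    using Ck_on_SucD(1)[OF Suc.prems(2) assms(2) T[OF that]] .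
  show ?case
  proof (rule Ck_on_SucI'[OF assms(1)])
    show "((\<lambda>x. g (f x)) has_derivative
        (\<lambda>e. frechet_derivative g (at (f x)) (frechet_derivative f (at x) e))) (at x)" if "x \<in> S" for x
      using has_derivative_compose[OF Ck_on_SucD(1)[OF Suc.prems(1) assms(1) that] dg[OF that]] .
    show "Ck_on k (\<lambda>x. frechet_derivative g (at (f x)) (frechet_derivative f (at x) e)) S" for e
    proof (rule Ck_on_linear_apply[OF assms(1)])
      show "linear (frechet_derivative g (at (f x)))" if "x \<in> S" for x
        using dg[OF that] has_derivative_linear by blast
    qed (intro Suc.IH Ck_on_SucD(2)[OF Suc.prems(1)] Ck_on_SucD(2)[OF Suc.prems(2)]
        Ck_on_Suc_imp[OF Suc.prems(1)])+
  qed
qed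

section \<open>Linear systems with coefficients depending on a point\<close>

text \<open>The term of the product rule with the derivative of \<open>c\<close> would carry the
  factor \<open>F x = 0\<close>, so continuity of \<open>c\<close> suffices.\<close>

lemma has_derivative_scaleR_vanishing:
  fixes F :: "'a::real_normed_vector \<Rightarrow> 'b::real_normed_vector"
  assumes c: "isCont c x" and F: "(F has_derivative F') (at x)" and "F x = 0"
  shows "((\<lambda>y. c y *\<^sub>R F y) has_derivative (\<lambda>h. c x *\<^sub>R F' h)) (at x)"
proof -
  obtain B where B: "\<And>h. norm (F' h) \<le> norm h * B" "0 < B"
    using bounded_linear.pos_bounded[OF has_derivative_bounded_linear[OF F]] by blast
  let ?q = "\<lambda>y. norm (F y - F x - F' (y - x)) / norm (y - x)"
  \<comment> \<open>Split \<open>c y\<close> as \<open>(c y - c x) + c x\<close>. The first summand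
    contributes a term of order o(norm (y - x)), because \<open>F y\<close> is of order O(norm (y -
    x)) and the factor in front tends to 0.\<close>
  have "((\<lambda>y. (c y - c x) *\<^sub>R F y) has_derivative (\<lambda>h. 0)) (at x)"
    unfolding has_derivative_iff_norm
  proof (intro conjI bounded_linear_zero, rule tendsto_sandwich[where f="\<lambda>_. 0"])
    have "(\<lambda>y. \<bar>c y - c x\<bar> * (?q y + B)) \<midarrow>x\<rightarrow> \<bar>c x - c x\<bar> * (0 + B)"
      using c F by (intro tendsto_intros) (auto simp: isCont_def has_derivative_iff_norm)
    then show "(\<lambda>y. \<bar>c y - c x\<bar> * (?q y + B)) \<midarrow>x\<rightarrow> 0" by simp
    have "norm (F y) / norm (y - x) \<le> ?q y + B" if "y \<noteq> x" for y
    proof -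
      have "norm (F y) \<le> norm (F y - F' (y - x)) + norm (F' (y - x))"
        by (metis diff_add_cancel norm_triangle_ineq)
      also have "\<dots> \<le> norm (F y - F' (y - x)) + norm (y - x) * B" using B(1) by simp
      finally show ?thesis using that \<open>F x = 0\<close> by (simp add: field_simps)
    qed
    then have "\<bar>c y - c x\<bar> * (norm (F y) / norm (y - x)) \<le> \<bar>c y - c x\<bar> * (?q y + B)" if "y \<noteq> x" for y
      using that by (intro mult_left_mono) auto
    then show "\<forall>\<^sub>F y in at x. norm ((c y - c x) *\<^sub>R F y - (c x - c x) *\<^sub>R F x - 0) / norm (y - x)
        \<le> \<bar>c y - c x\<bar> * (?q y + B)"
      by (auto simp: eventually_at_filter)
  qed auto
  then have "((\<lambda>y. (c y - c x) *\<^sub>R F y + c x *\<^sub>R F y) has_derivative (\<lambda>h. 0 + c x *\<^sub>R F' h)) (at x)"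
    by (intro has_derivative_add has_derivative_scaleR_right F)
  then show ?thesis by (simp add: algebra_simps)
qed

text \<open>A left inverse \<open>K\<close> of \<open>L x\<close> expresses \<open>v y - v x\<close>
  through \<open>w y - w x\<close> and the error \<open>L y (v y) - L x (v y)\<close>. The error is
  small relative to \<open>v y\<close>, hence to \<open>v x\<close> plus the very difference being
  estimated, and that last part is absorbed on the left.\<close>

lemma linear_solve_isCont:
  fixes L :: "'a::real_normed_vector \<Rightarrow> 'p::euclidean_space \<Rightarrow> 'b::euclidean_space"
  assumes S: "open S" "x \<in> S" and lin: "\<And>y. y \<in> S \<Longrightarrow> linear (L y)" and "inj (L x)"
    and L: "\<And>e. isCont (\<lambda>y. L y e) x" and w: "isCont w x"
    and eq: "\<And>y. y \<in> S \<Longrightarrow> L y (v y) = w y"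
  shows "isCont v x"
proof -
  obtain K where K: "linear K" "K \<circ> L x = id"
    using linear_injective_left_inverse lin[OF S(2)] \<open>inj (L x)\<close> by blast
  obtain B where B: "B > 0" "\<And>z. norm (K z) \<le> B * norm z" using linear_bounded_pos[OF K(1)] by blast
  \<comment> \<open>A bound for the operator norm of \<open>L y - L x\<close> that uses only the
    values on basis vectors, where continuity is assumed.\<close>
  define \<epsilon> where "\<epsilon> y = (\<Sum>i\<in>Basis. norm (L y i - L x i))" for y
  have \<epsilon>: "\<epsilon> \<midarrow>x\<rightarrow> 0"
  proof -
    have "\<epsilon> \<midarrow>x\<rightarrow> (\<Sum>i\<in>Basis. norm (L x i - L x i))"
      unfolding \<epsilon>_def using L by (intro tendsto_intros) (auto simp: isCont_def)
    then show ?thesis by simp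
  qed
  have diff: "norm (L y z - L x z) \<le> \<epsilon> y * norm z" if "y \<in> S" for y z
  proof -
    have "L y z - L x z = (\<Sum>i\<in>Basis. (z \<bullet> i) *\<^sub>R (L y i - L x i))"
      using linear_eq_sum_Basis[OF lin[OF that], of z] linear_eq_sum_Basis[OF lin[OF S(2)], of z]
      by (simp add: scaleR_diff_right sum_subtractf)
    also have "norm \<dots> \<le> (\<Sum>i\<in>Basis. norm z * norm (L y i - L x i))"
      by (intro sum_norm_le) (simp add: Basis_le_norm mult_right_mono)
    finally show ?thesis by (simp add: \<epsilon>_def sum_distrib_left mult.commute)
  qed
  have "norm (v y - v x) \<le> 2 * B * (norm (w y - w x) + \<epsilon> y * norm (v x))"
    if y: "y \<in> S" and small: "\<epsilon> y < 1 / (2 * B)" for y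
  proof -
    have "v y - v x = K (L x (v y) - L x (v x))"
      using K by (simp add: linear_diff pointfree_idE)
    also have "L x (v y) - L x (v x) = (w y - w x) - (L y (v y) - L x (v y))"
      using eq[OF y] eq[OF S(2)] by simp
    finally have "norm (v y - v x) \<le> B * norm ((w y - w x) - (L y (v y) - L x (v y)))"
      using B(2) by simp
    also have "\<dots> \<le> B * (norm (w y - w x) + \<epsilon> y * norm (v y))"
      using B(1) by (intro mult_left_mono order_trans[OF norm_triangle_ineq4 add_left_mono[OF diff[OF y]]]) auto
    also have "\<dots> \<le> B * (norm (w y - w x) + \<epsilon> y * (norm (v x) + norm (v y - v x)))"
      using B(1) norm_triangle_sub[of "v y" "v x"]
      by (intro mult_left_mono add_left_mono) (auto simp: \<epsilon>_def intro: sum_nonneg)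
    also have "\<dots> = B * (norm (w y - w x) + \<epsilon> y * norm (v x)) + (B * \<epsilon> y) * norm (v y - v x)"
      by (simp add: algebra_simps)
    \<comment> \<open>Absorption: half of \<open>norm (v y - v x)\<close> moves to the left, which
      produces the factor 2 in the claimed bound and the threshold
      \<open>1 / (2 * B)\<close>.\<close>
    also have "(B * \<epsilon> y) * norm (v y - v x) \<le> 1 / 2 * norm (v y - v x)"
      using small B(1) by (intro mult_right_mono) (auto simp: field_simps)
    finally show ?thesis by simp
  qed
  moreover have "\<forall>\<^sub>F y in at x. y \<in> S \<and> \<epsilon> y < 1 / (2 * B)"
    using order_tendstoD(2)[OF \<epsilon>, of "1 / (2 * B)"] B(1) eventually_at_in_open'[OF S]
    by (auto elim: eventually_elim2)
  ultimately have "\<forall>\<^sub>F y in at x. norm (v y - v x) \<le> 2 * B * (norm (w y - w x) + \<epsilon> y * norm (v x))"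
    by (auto elim: eventually_mono)
  moreover have "(\<lambda>y. 2 * B * (norm (w y - w x) + \<epsilon> y * norm (v x)))
      \<midarrow>x\<rightarrow> 2 * B * (norm (w x - w x) + 0 * norm (v x))"
    using w by (intro tendsto_intros \<epsilon>) (auto simp: isCont_def)
  ultimately have "(\<lambda>y. v y - v x) \<midarrow>x\<rightarrow> 0"
    using Lim_null_comparison by fastforce
  then show ?thesis unfolding isCont_def by (rule LIM_zero_cancel)
qed

text \<open>Near \<open>x\<close> the solution satisfies
  \<open>v y = K (w y - \<Sum> (v y \<bullet> i) (L y i - L x i))\<close> with \<open>K\<close> a
  left inverse of \<open>L x\<close>. Each factor \<open>L y i - L x i\<close> vanishes at
  \<open>x\<close>, so the right side is differentiable although \<open>v\<close> is so far only
  continuous.\<close>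

lemma linear_solve_has_derivative:
  fixes L :: "'a::real_normed_vector \<Rightarrow> 'p::euclidean_space \<Rightarrow> 'b::euclidean_space"
  assumes S: "open S" "x \<in> S" and lin: "\<And>y. y \<in> S \<Longrightarrow> linear (L y)" and inj: "inj (L x)"
    and L: "\<And>e. ((\<lambda>y. L y e) has_derivative L' e) (at x)" and w: "(w has_derivative w') (at x)"
    and eq: "\<And>y. y \<in> S \<Longrightarrow> L y (v y) = w y"
  obtains v' where "(v has_derivative v') (at x)"
    and "\<And>h. L x (v' h) = w' h - (\<Sum>i\<in>Basis. (v x \<bullet> i) *\<^sub>R L' i h)"
proof -
  have cont: "isCont v x"
    using linear_solve_isCont[where L=L and w=w, OF S lin inj _ _ eq] L w has_derivative_continuous by blast
  obtain K where K: "linear K" "K \<circ> L x = id"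
    using linear_injective_left_inverse lin[OF S(2)] inj by blast
  define v' where "v' h = K (w' h - (\<Sum>i\<in>Basis. (v x \<bullet> i) *\<^sub>R L' i h))" for h
  have v: "(v has_derivative v') (at x)"
  proof (rule has_derivative_transform_within_open[OF _ S])
    show "((\<lambda>y. K (w y - (\<Sum>i\<in>Basis. (v y \<bullet> i) *\<^sub>R (L y i - L x i)))) has_derivative v') (at x)"
      unfolding v'_def
    proof (intro bounded_linear.has_derivative[OF linear_conv_bounded_linear[THEN iffD1, OF K(1)]]
        has_derivative_diff w has_derivative_sum has_derivative_scaleR_vanishing)
      show "((\<lambda>y. L y i - L x i) has_derivative L' i) (at x)" for i
        using has_derivative_diff[OF L has_derivative_const] by simp
      show "isCont (\<lambda>y. v y \<bullet> i) x" for i using cont by (intro continuous_intros)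
    qed simp
    show "K (w y - (\<Sum>i\<in>Basis. (v y \<bullet> i) *\<^sub>R (L y i - L x i))) = v y" if "y \<in> S" for y
    proof -
      have "w y - (\<Sum>i\<in>Basis. (v y \<bullet> i) *\<^sub>R (L y i - L x i)) = L x (v y)"
        using linear_eq_sum_Basis[OF lin[OF that], of "v y"] linear_eq_sum_Basis[OF lin[OF S(2)], of "v y"]
        by (simp add: scaleR_diff_right sum_subtractf eq[OF that])
      then show ?thesis using K(2) by (simp add: pointfree_idE)
    qed
  qed
  \<comment> \<open>\<open>K\<close> is only a left inverse, so the definition of \<open>v'\<close>
    does not directly give an equation for \<open>L x (v' h)\<close>. With \<open>v\<close> now
    known to be differentiable, the ordinary product rule on \<open>L y (v y) = w y\<close> and
    uniqueness of derivatives supply it.\<close>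
  have "((\<lambda>y. \<Sum>i\<in>Basis. (v y \<bullet> i) *\<^sub>R L y i) has_derivative
      (\<lambda>h. \<Sum>i\<in>Basis. (v x \<bullet> i) *\<^sub>R L' i h + (v' h \<bullet> i) *\<^sub>R L x i)) (at x)"
    by (intro has_derivative_sum has_derivative_scaleR has_derivative_inner_left v L)
  moreover have "(\<Sum>i\<in>Basis. (v y \<bullet> i) *\<^sub>R L y i) = w y" if "y \<in> S" for y
    using linear_eq_sum_Basis[OF lin[OF that], of "v y"] eq[OF that] by simp
  ultimately have "(w has_derivative
      (\<lambda>h. \<Sum>i\<in>Basis. (v x \<bullet> i) *\<^sub>R L' i h + (v' h \<bullet> i) *\<^sub>R L x i)) (at x)"
    using has_derivative_transform_within_open[OF _ S] by blast
  from has_derivative_unique[OF w this]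
  have "w' h = (\<Sum>i\<in>Basis. (v x \<bullet> i) *\<^sub>R L' i h) + L x (v' h)" for h
    by (simp add: sum.distrib linear_eq_sum_Basis[OF lin[OF S(2)], symmetric])
  then show thesis using that[OF v] by simp
qed

text \<open>Only the right-hand side changes under differentiation, so the induction keeps
  \<open>L\<close> fixed and generalizes \<open>v\<close> and \<open>w\<close>.\<close>

lemma Ck_on_linear_solve:
  fixes L :: "'a::euclidean_space \<Rightarrow> 'p::euclidean_space \<Rightarrow> 'b::euclidean_space"
  assumes S: "open S" and lin: "\<And>x. x \<in> S \<Longrightarrow> linear (L x)" and inj: "\<And>x. x \<in> S \<Longrightarrow> inj (L x)"
    and L: "\<And>e. Ck_on k (\<lambda>x. L x e) S" and w: "Ck_on k w S"
    and eq: "\<And>x. x \<in> S \<Longrightarrow> L x (v x) = w x"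
  shows "Ck_on k v S"
  using L w eq
proof (induction k arbitrary: v w)
  case 0
  then have "isCont v x" if "x \<in> S" for x
    using linear_solve_isCont[where L=L and w=w and v=v, OF S that lin inj[OF that]] that
    by (auto simp: continuous_on_eq_continuous_at[OF S])
  then show ?case by (simp add: continuous_at_imp_continuous_on)
next
  case (Suc k)
  let ?L' = "\<lambda>x e. frechet_derivative (\<lambda>y. L y e) (at x)"
  let ?w' = "\<lambda>x. frechet_derivative w (at x)"
  \<comment> \<open>The difference is written with the factor \<open>-1\<close> so that closure
    under sums and scalar multiples applies to it.\<close>
  have "\<exists>v'. (v has_derivative v') (at x) \<and>
      (\<forall>h. L x (v' h) = ?w' x h + (-1) *\<^sub>R (\<Sum>i\<in>Basis. (v x \<bullet> i) *\<^sub>R ?L' x i h))" if "x \<in> S" for x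
  proof (rule linear_solve_has_derivative[where L=L and w=w and v=v, OF S that lin inj[OF that]
        Ck_on_SucD(1)[OF Suc.prems(1) S that] Ck_on_SucD(1)[OF Suc.prems(2) S that] Suc.prems(3)])
    show ?thesis if "(v has_derivative v') (at x)"
      "\<And>h. L x (v' h) = ?w' x h - (\<Sum>i\<in>Basis. (v x \<bullet> i) *\<^sub>R ?L' x i h)" for v'
      using that by (intro exI[of _ v']) simp
  qed
  then have "\<forall>x\<in>S. \<exists>v'. (v has_derivative v') (at x) \<and>
      (\<forall>h. L x (v' h) = ?w' x h + (-1) *\<^sub>R (\<Sum>i\<in>Basis. (v x \<bullet> i) *\<^sub>R ?L' x i h))" by blast
  from bchoice[OF this] obtain v' where v': "\<And>x. x \<in> S \<Longrightarrow> (v has_derivative v' x) (at x)"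
    and Lv': "\<And>x h. x \<in> S \<Longrightarrow> L x (v' x h) = ?w' x h + (-1) *\<^sub>R (\<Sum>i\<in>Basis. (v x \<bullet> i) *\<^sub>R ?L' x i h)"
    by blast
  \<comment> \<open>The new right-hand side contains \<open>v\<close>. Its regularity comes from the
    induction hypothesis for the original system, before the hypothesis is used again for
    \<open>v'\<close>.\<close>
  have v: "Ck_on k v S"
    by (intro Suc.IH[where w=w] Ck_on_Suc_imp[OF Suc.prems(1)] Ck_on_Suc_imp[OF Suc.prems(2)] Suc.prems(3))
  show ?case
  proof (rule Ck_on_SucI'[OF S v'])
    show "Ck_on k (\<lambda>x. v' x h) S" for h
    proof (rule Suc.IH)
      show "Ck_on k (\<lambda>x. L x e) S" for e using Ck_on_Suc_imp[OF Suc.prems(1)] .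
      show "L x (v' x h) = ?w' x h + (-1) *\<^sub>R (\<Sum>i\<in>Basis. (v x \<bullet> i) *\<^sub>R ?L' x i h)" if "x \<in> S" for x
        using Lv'[OF that] .
      show "Ck_on k (\<lambda>x. ?w' x h + (-1) *\<^sub>R (\<Sum>i\<in>Basis. (v x \<bullet> i) *\<^sub>R ?L' x i h)) S"
        by (intro Ck_on_add[OF S] Ck_on_scaleR[OF S Ck_on_const[OF S]] Ck_on_scaleR[OF S] Ck_on_sum[OF S]
            Ck_on_bounded_linear[OF bounded_linear_inner_left S v]
            Ck_on_SucD(2)[OF Suc.prems(1)] Ck_on_SucD(2)[OF Suc.prems(2)])
    qed
  qed
qed

section \<open>The calculus rules for smooth maps\<close>

lemma smooth_on_frechet_derivative:
  assumes "smooth_on f S"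
  shows "open S \<Longrightarrow> x \<in> S \<Longrightarrow> (f has_derivative frechet_derivative f (at x)) (at x)"
    and "smooth_on (\<lambda>x. frechet_derivative f (at x) e) S"
  using assms Ck_on_SucD[of _ f S] unfolding smooth_on_def by blast+

lemma smooth_on_cong:
  assumes "smooth_on f S" "open S" "\<And>x. x \<in> S \<Longrightarrow> f x = g x"
  shows "smooth_on g S"
  using assms Ck_on_cong unfolding smooth_on_def by blast

lemma smooth_on_local:
  assumes "\<And>x. x \<in> S \<Longrightarrow> \<exists>U. open U \<and> x \<in> U \<and> smooth_on f U"
  shows "smooth_on f S"
  unfolding smooth_on_def
proof
  show "Ck_on k f S" for k
    by (rule Ck_on_local) (use assms in \<open>force simp: smooth_on_def\<close>)
qed

lemma smooth_on_const: "open S \<Longrightarrow> smooth_on (\<lambda>x. c) S"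
  by (simp add: smooth_on_def Ck_on_const)

lemma smooth_on_bounded_linear:
  "bounded_linear h \<Longrightarrow> open S \<Longrightarrow> smooth_on f S \<Longrightarrow> smooth_on (\<lambda>x. h (f x)) S"
  by (simp add: smooth_on_def Ck_on_bounded_linear)

lemma smooth_on_add:
  "open S \<Longrightarrow> smooth_on f S \<Longrightarrow> smooth_on g S \<Longrightarrow> smooth_on (\<lambda>x. f x + g x) S"
  by (simp add: smooth_on_def Ck_on_add)

lemma smooth_on_scaleR:
  "open S \<Longrightarrow> smooth_on c S \<Longrightarrow> smooth_on f S \<Longrightarrow> smooth_on (\<lambda>x. c x *\<^sub>R f x) S"
  by (simp add: smooth_on_def Ck_on_scaleR)

lemma smooth_on_linear_apply:
  fixes L :: "'a::euclidean_space \<Rightarrow> 'p::euclidean_space \<Rightarrow> 'b::real_normed_vector"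
  assumes "open S" "\<And>x. x \<in> S \<Longrightarrow> linear (L x)" "\<And>e. smooth_on (\<lambda>x. L x e) S" "smooth_on v S"
  shows "smooth_on (\<lambda>x. L x (v x)) S"
  unfolding smooth_on_def
proof
  show "Ck_on k (\<lambda>x. L x (v x)) S" for k
    by (rule Ck_on_linear_apply[where L=L, OF assms(1,2)]) (use assms(3,4) in \<open>simp_all add: smooth_on_def\<close>)
qed

lemma smooth_on_compose:
  assumes "open S" "open T" "f ` S \<subseteq> T" "smooth_on f S" "smooth_on g T"
  shows "smooth_on (\<lambda>x. g (f x)) S"
  unfolding smooth_on_def
proof
  show "Ck_on k (\<lambda>x. g (f x)) S" for k
    by (rule Ck_on_compose[OF assms(1-3)]) (use assms(4,5) in \<open>simp_all add: smooth_on_def\<close>)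
qed

lemma smooth_on_linear_solve:
  fixes L :: "'a::euclidean_space \<Rightarrow> 'p::euclidean_space \<Rightarrow> 'b::euclidean_space"
  assumes "open S" "\<And>x. x \<in> S \<Longrightarrow> linear (L x)" "\<And>x. x \<in> S \<Longrightarrow> inj (L x)"
    and "\<And>e. smooth_on (\<lambda>x. L x e) S" "smooth_on w S"
    and "\<And>x. x \<in> S \<Longrightarrow> L x (v x) = w x"
  shows "smooth_on v S"
  unfolding smooth_on_def
proof
  show "Ck_on k v S" for k
    by (rule Ck_on_linear_solve[where L=L and w=w, OF assms(1-3) _ _ assms(6)]) (use assms(4,5) in \<open>simp_all add: smooth_on_def\<close>)
qed

subsection \<open>Tangent spaces and differentials in charts\<close>

text \<open>With \<open>f = id\<close> this is \<open>transition_deriv\<close>. One set of lemmas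
  thus serves coordinate changes and differentials of maps alike.\<close>

definition map_deriv ::
    "('a \<Rightarrow> 'b) \<Rightarrow> ('a, 'e::euclidean_space) chart \<Rightarrow> ('b, 'f::euclidean_space) chart \<Rightarrow> 'a \<Rightarrow> 'e \<Rightarrow> 'f" where
  "map_deriv f c d p = frechet_derivative (snd d \<circ> f \<circ> chart_inv c) (at (snd c p))"

lemma transition_deriv_eq: "transition_deriv c d p = map_deriv id c d p"
  by (simp add: transition_deriv_def map_deriv_def)

lemma charts_atD:
  assumes "c \<in> charts_at M p"
  shows "c \<in> atlas M" "p \<in> fst c"
  using assms by (auto simp: charts_at_def)

context
  fixes M :: "('a, 'e::euclidean_space) manifold"
  assumes M: "smooth_manifold M"
begin

lemma charts_at_nonempty: "p \<in> points M \<Longrightarrow> charts_at M p \<noteq> {}"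
proof -
  assume "p \<in> points M"
  then have "p \<in> (\<Union>c\<in>atlas M. fst c)" using M by (simp add: smooth_manifold_def)
  then show ?thesis unfolding charts_at_def by blast
qed

lemma chart_domain:
  assumes "c \<in> atlas M"
  shows "openin (mtop M) (fst c)" "fst c \<subseteq> points M"
  using assms M by (auto simp: smooth_manifold_def openin_subset)

lemma chart_homeomorphic:
  assumes "c \<in> atlas M"
  shows "homeomorphic_map (subtopology (mtop M) (fst c)) (top_of_set (snd c ` fst c)) (snd c)"
    "open (snd c ` fst c)"
  using assms M by (auto simp: smooth_manifold_def)

lemma chart_inv_chart:
  assumes "c \<in> atlas M" "p \<in> fst c"
  shows "chart_inv c (snd c p) = p"
proof -
  have "inj_on (snd c) (fst c)"
    using homeomorphic_imp_injective_map[OF chart_homeomorphic(1)[OF assms(1)]] chart_domain[OF assms(1)]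
    by (simp add: Int_absorb1)
  then show ?thesis using assms(2) by (simp add: chart_inv_def)
qed

lemma chart_inv_in:
  assumes "c \<in> atlas M" "x \<in> snd c ` (fst c \<inter> A)"
  shows "chart_inv c x \<in> fst c" "chart_inv c x \<in> A" "snd c (chart_inv c x) = x"
  using assms by (auto simp: chart_inv_chart)

lemma open_chart_image:
  assumes "c \<in> atlas M" "openin (mtop M) U"
  shows "open (snd c ` (fst c \<inter> U))"
proof -
  have "openin (subtopology (mtop M) (fst c)) (fst c \<inter> U)"
    using assms(2) by (metis Int_commute openin_subtopology_Int)
  then have "openin (top_of_set (snd c ` fst c)) (snd c ` (fst c \<inter> U))"
    using homeomorphic_map_openness chart_homeomorphic(1)[OF assms(1)] by (metis openin_subset)
  then show ?thesis
    using openin_open_trans chart_homeomorphic(2)[OF assms(1)] by blast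
qed

end

text \<open>Compatibility of the charts of an atlas is smoothness of \<open>id\<close>, so
  everything proved for smooth maps applies to coordinate changes.\<close>

lemma smooth_map_id:
  assumes "smooth_manifold M"
  shows "smooth_map M M id"
  using assms by (auto simp: smooth_map_def smooth_manifold_def)

lemma smooth_map_points: "smooth_map M N f \<Longrightarrow> p \<in> points M \<Longrightarrow> f p \<in> points N"
  by (auto simp: smooth_map_def continuous_map_def)

lemma open_chart_preimage:
  assumes M: "smooth_manifold M" and N: "smooth_manifold N" and f: "smooth_map M N f"
    and c: "c \<in> atlas M" and d: "d \<in> atlas N"
  shows "open (snd c ` (fst c \<inter> f -` fst d))"
proof -
  have "openin (mtop M) {p \<in> points M. f p \<in> fst d}"
    using f chart_domain(1)[OF N d] openin_continuous_map_preimage by (auto simp: smooth_map_def)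
  from open_chart_image[OF M c this] have "open (snd c ` (fst c \<inter> {p \<in> points M. f p \<in> fst d}))" .
  moreover have "fst c \<inter> {p \<in> points M. f p \<in> fst d} = fst c \<inter> f -` fst d"
    using chart_domain(2)[OF M c] by blast
  ultimately show ?thesis by simp
qed

lemma chart_rep_has_derivative:
  assumes M: "smooth_manifold M" and N: "smooth_manifold N" and f: "smooth_map M N f"
    and c: "c \<in> charts_at M p" and d: "d \<in> charts_at N (f p)"
  shows "((snd d \<circ> f \<circ> chart_inv c) has_derivative map_deriv f c d p) (at (snd c p))"
  unfolding map_deriv_def
proof (rule smooth_on_frechet_derivative(1))
  show "smooth_on (snd d \<circ> f \<circ> chart_inv c) (snd c ` (fst c \<inter> f -` fst d))"
    using f charts_atD[OF c] charts_atD[OF d] by (auto simp: smooth_map_def)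
  show "open (snd c ` (fst c \<inter> f -` fst d))"
    by (intro open_chart_preimage[OF M N f] charts_atD[OF c] charts_atD[OF d])
  show "snd c p \<in> snd c ` (fst c \<inter> f -` fst d)"
    using charts_atD[OF c] charts_atD[OF d] by auto
qed

lemma linear_map_deriv:
  assumes "smooth_manifold M" "smooth_manifold N" "smooth_map M N f"
    and "c \<in> charts_at M p" "d \<in> charts_at N (f p)"
  shows "linear (map_deriv f c d p)"
  using chart_rep_has_derivative[OF assms] has_derivative_linear by blast

text \<open>The chain rule, valid because both chart representations agree on the open set of points
  that \<open>f\<close> sends into \<open>d\<close>. Taking one or both maps to be \<open>id\<close>
  gives the cocycle rule for coordinate changes and the independence of differentials from
  charts.\<close>

lemma map_deriv_compose:
  assumes M: "smooth_manifold M" and N: "smooth_manifold N" and Q: "smooth_manifold Q"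
    and f: "smooth_map M N f" and h: "smooth_map N Q h"
    and c: "c \<in> charts_at M p" and d: "d \<in> charts_at N (f p)" and k: "k \<in> charts_at Q (h (f p))"
  shows "map_deriv (h \<circ> f) c k p e = map_deriv h d k (f p) (map_deriv f c d p e)"
proof -
  let ?U = "snd c ` (fst c \<inter> f -` fst d)"
  have p: "chart_inv c (snd c p) = p" using chart_inv_chart[OF M charts_atD[OF c]] .
  have fp: "snd d (f (chart_inv c (snd c p))) = snd d (f p)" by (simp add: p)
  have "((snd k \<circ> h \<circ> chart_inv d) \<circ> (snd d \<circ> f \<circ> chart_inv c) has_derivative
      map_deriv h d k (f p) \<circ> map_deriv f c d p) (at (snd c p))"
    using chart_rep_has_derivative[OF N Q h d k] fp
    by (intro diff_chain_at chart_rep_has_derivative[OF M N f c d]) simp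
  then have "((snd k \<circ> (h \<circ> f) \<circ> chart_inv c) has_derivative
      map_deriv h d k (f p) \<circ> map_deriv f c d p) (at (snd c p))"
  proof (rule has_derivative_transform_within_open)
    show "open ?U" by (intro open_chart_preimage[OF M N f] charts_atD[OF c] charts_atD[OF d])
    show "snd c p \<in> ?U" using charts_atD[OF c] charts_atD[OF d] by auto
    show "((snd k \<circ> h \<circ> chart_inv d) \<circ> (snd d \<circ> f \<circ> chart_inv c)) x = (snd k \<circ> (h \<circ> f) \<circ> chart_inv c) x"
      if "x \<in> ?U" for x
      using chart_inv_in[OF M charts_atD(1)[OF c] that] chart_inv_chart[OF N charts_atD(1)[OF d]] by simp
  qed
  from fun_cong[OF frechet_derivative_at[OF this], of e] show ?thesis by (simp add: map_deriv_def)
qed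

lemma map_deriv_id_self:
  assumes M: "smooth_manifold M" and c: "c \<in> charts_at M p"
  shows "map_deriv id c c p e = e"
proof -
  have "((\<lambda>x. x) has_derivative (\<lambda>e. e)) (at (snd c p))" by simp
  then have "((snd c \<circ> id \<circ> chart_inv c) has_derivative (\<lambda>e. e)) (at (snd c p))"
  proof (rule has_derivative_transform_within_open)
    show "open (snd c ` fst c)" using chart_homeomorphic(2)[OF M charts_atD(1)[OF c]] .
    show "snd c p \<in> snd c ` fst c" using charts_atD(2)[OF c] by simp
    show "x = (snd c \<circ> id \<circ> chart_inv c) x" if "x \<in> snd c ` fst c" for x
      using that chart_inv_chart[OF M charts_atD(1)[OF c]] by auto
  qed
  from fun_cong[OF frechet_derivative_at[OF this], of e] show ?thesis by (simp add: map_deriv_def)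
qed

lemma tangent_spaceI:
  assumes "\<And>c. c \<notin> charts_at M p \<Longrightarrow> v c = 0"
    "\<And>c d. c \<in> charts_at M p \<Longrightarrow> d \<in> charts_at M p \<Longrightarrow> v d = map_deriv id c d p (v c)"
  shows "v \<in> tangent_space M p"
  using assms unfolding tangent_space_def transition_deriv_eq by blast

lemma tangent_spaceD:
  assumes "v \<in> tangent_space M p" "c \<in> charts_at M p" "d \<in> charts_at M p"
  shows "v d = map_deriv id c d p (v c)"
  using assms unfolding tangent_space_def transition_deriv_eq by blast

lemma tangent_space_zero_off: "v \<in> tangent_space M p \<Longrightarrow> c \<notin> charts_at M p \<Longrightarrow> v c = 0"
  unfolding tangent_space_def by blast

text \<open>Coordinates in one chart determine all others, so equality of tangent vectors becomes
  one equation in the model space.\<close>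

lemma tangent_space_eqI:
  assumes "v \<in> tangent_space M p" "w \<in> tangent_space M p" "c \<in> charts_at M p" "v c = w c"
  shows "v = w"
proof
  show "v d = w d" for d
    using tangent_spaceD[OF assms(1,3)] tangent_spaceD[OF assms(2,3)] assms(4)
      tangent_space_zero_off[OF assms(1)] tangent_space_zero_off[OF assms(2)]
    by (cases "d \<in> charts_at M p") simp_all
qed

context
  fixes M :: "('a, 'e::euclidean_space) manifold"
  assumes M: "smooth_manifold M"
begin

lemma subspace_tangent_space: "subspace (tangent_space M p)"
proof -
  have lin: "linear (map_deriv id c d p)" if "c \<in> charts_at M p" "d \<in> charts_at M p" for c d
    using linear_map_deriv[OF M M smooth_map_id[OF M]] that by simp
  show ?thesis
  proof (rule subspaceI)
    show "0 \<in> tangent_space M p"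
      by (rule tangent_spaceI) (simp_all add: linear_0[OF lin])
    show "v + w \<in> tangent_space M p" if "v \<in> tangent_space M p" "w \<in> tangent_space M p" for v w
      by (rule tangent_spaceI)
        (simp_all add: linear_add[OF lin] tangent_space_zero_off[OF that(1)] tangent_space_zero_off[OF that(2)]
          tangent_spaceD[OF that(1), symmetric] tangent_spaceD[OF that(2), symmetric])
    show "r *\<^sub>R v \<in> tangent_space M p" if "v \<in> tangent_space M p" for r v
      by (rule tangent_spaceI)
        (simp_all add: scaleR_fun_def linear_scale[OF lin] tangent_space_zero_off[OF that]
          tangent_spaceD[OF that, symmetric])
  qed
qed

lemma coord_vec_self: "c \<in> charts_at M p \<Longrightarrow> coord_vec M c e p c = e"
  by (simp add: coord_vec_def transition_deriv_eq map_deriv_id_self[OF M])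

text \<open>The compatibility condition is the cocycle rule, that is the chain rule for two
  coordinate changes.\<close>

lemma coord_vec_in_tangent_space:
  assumes "c \<in> charts_at M p"
  shows "coord_vec M c e p \<in> tangent_space M p"
proof (rule tangent_spaceI)
  show "coord_vec M c e p k = map_deriv id d k p (coord_vec M c e p d)"
    if "d \<in> charts_at M p" "k \<in> charts_at M p" for d k
    using map_deriv_compose[OF M M M smooth_map_id[OF M] smooth_map_id[OF M] assms, of d k] that
    by (simp add: coord_vec_def transition_deriv_eq)
qed (simp add: coord_vec_def)

lemma coord_vec_coordinates:
  assumes "v \<in> tangent_space M p" "c \<in> charts_at M p"
  shows "coord_vec M c (v c) p = v"
  using assms tangent_space_eqI coord_vec_in_tangent_space coord_vec_self by metis

lemma coord_vec_add_scaleR: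
  assumes "c \<in> charts_at M p"
  shows "coord_vec M c (x + y) p = coord_vec M c x p + coord_vec M c y p"
    "coord_vec M c (r *\<^sub>R x) p = r *\<^sub>R coord_vec M c x p"
  by (intro tangent_space_eqI[OF _ _ assms] subspace_add subspace_scale subspace_tangent_space
      coord_vec_in_tangent_space assms, simp add: coord_vec_self assms scaleR_fun_def)+

end

section \<open>Differentials, and smoothness along a map\<close>

lemma linear_on_subspaceD:
  assumes "linear_on_subspace V L" "v \<in> V"
  shows "w \<in> V \<Longrightarrow> L (v + w) = L v + L w" "L (r *\<^sub>R v) = r *\<^sub>R L v"
  using assms by (auto simp: linear_on_subspace_def)

lemma linear_on_subspaceI:
  assumes "\<And>v w. v \<in> V \<Longrightarrow> w \<in> V \<Longrightarrow> L (v + w) = L v + L w"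
    "\<And>r v. v \<in> V \<Longrightarrow> L (r *\<^sub>R v) = r *\<^sub>R L v"
  shows "linear_on_subspace V L"
  using assms by (simp add: linear_on_subspace_def)

context
  fixes M :: "('a, 'e::euclidean_space) manifold" and N :: "('b, 'f::euclidean_space) manifold" and f
  assumes M: "smooth_manifold M" and N: "smooth_manifold N" and f: "smooth_map M N f"
begin

text \<open>The definition picks some chart \<open>c'\<close>. Passing from \<open>c\<close> to
  \<open>c'\<close> by a coordinate change and applying the chain rule removes the choice.\<close>

lemma differential_in_chart:
  assumes v: "v \<in> tangent_space M p" and c: "c \<in> charts_at M p" and d: "d \<in> charts_at N (f p)"
  shows "differential M N f p v d = map_deriv f c d p (v c)"
proof -
  define c' where "c' = (SOME c. c \<in> charts_at M p)"
  have c': "c' \<in> charts_at M p" unfolding c'_def by (rule someI[of _ c]) (rule c)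
  have "differential M N f p v d = map_deriv f c' d p (v c')"
    using d by (simp add: differential_def map_deriv_def Let_def c'_def)
  also have "\<dots> = map_deriv f c' d p (map_deriv id c c' p (v c))"
    using tangent_spaceD[OF v c c'] by simp
  also have "\<dots> = map_deriv f c d p (v c)"
    using map_deriv_compose[OF M M N smooth_map_id[OF M] f c, of c' d] c' d by simp
  finally show ?thesis .
qed

lemma differential_in_tangent_space:
  assumes v: "v \<in> tangent_space M p" and p: "p \<in> points M"
  shows "differential M N f p v \<in> tangent_space N (f p)"
proof -
  obtain c where c: "c \<in> charts_at M p" using charts_at_nonempty[OF M p] by blast
  have "differential M N f p v k = map_deriv id d k (f p) (differential M N f p v d)"
    if "d \<in> charts_at N (f p)" "k \<in> charts_at N (f p)" for d k
    using map_deriv_compose[OF M N N f smooth_map_id[OF N] c, of d k] that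
    by (simp add: differential_in_chart[OF v c])
  then show ?thesis by (rule tangent_spaceI[rotated]) (simp_all add: differential_def)
qed

lemma linear_differential:
  assumes p: "p \<in> points M"
  shows "linear_on_subspace (tangent_space M p) (differential M N f p)"
proof -
  obtain c where c: "c \<in> charts_at M p" using charts_at_nonempty[OF M p] by blast
  obtain d where d: "d \<in> charts_at N (f p)"
    using charts_at_nonempty[OF N smooth_map_points[OF f p]] by blast
  note lin = linear_map_deriv[OF M N f c d]
  note M_sub = subspace_tangent_space[OF M] and N_sub = subspace_tangent_space[OF N]
  show ?thesis
  proof (rule linear_on_subspaceI)
    fix v w r assume v: "v \<in> tangent_space M p"
    show "differential M N f p (r *\<^sub>R v) = r *\<^sub>R differential M N f p v"
      using subspace_scale[OF M_sub v]
      by (intro tangent_space_eqI[OF _ _ d] differential_in_tangent_space p subspace_scale[OF M_sub]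
          subspace_scale[OF N_sub] v) (simp_all add: v differential_in_chart[OF _ c d] scaleR_fun_def linear_scale[OF lin])
    assume w: "w \<in> tangent_space M p"
    show "differential M N f p (v + w) = differential M N f p v + differential M N f p w"
      using subspace_add[OF M_sub v w]
      by (intro tangent_space_eqI[OF _ _ d] differential_in_tangent_space p subspace_add[OF M_sub]
          subspace_add[OF N_sub] v w) (simp_all add: v w differential_in_chart[OF _ c d] linear_add[OF lin])
  qed
qed

lemma smooth_on_differential:
  assumes c: "c \<in> atlas M" and d: "d \<in> atlas N" and U: "U = snd c ` (fst c \<inter> f -` fst d)"
    and V: "\<And>x. x \<in> U \<Longrightarrow> V x \<in> tangent_space M (chart_inv c x)" and "smooth_on (\<lambda>x. V x c) U"
  shows "smooth_on (\<lambda>x. differential M N f (chart_inv c x) (V x) d) U"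
proof -
  let ?\<phi> = "snd d \<circ> f \<circ> chart_inv c"
  have open_U: "open U" unfolding U by (rule open_chart_preimage[OF M N f c d])
  have \<phi>: "smooth_on ?\<phi> U" using f c d by (auto simp: smooth_map_def U)
  have "smooth_on (\<lambda>x. frechet_derivative ?\<phi> (at x) (V x c)) U"
  proof (rule smooth_on_linear_apply[where L="\<lambda>x. frechet_derivative ?\<phi> (at x)", OF open_U])
    show "linear (frechet_derivative ?\<phi> (at x))" if "x \<in> U" for x
      using has_derivative_linear[OF smooth_on_frechet_derivative(1)[OF \<phi> open_U that]] .
    show "smooth_on (\<lambda>x. frechet_derivative ?\<phi> (at x) e) U" for e
      by (rule smooth_on_frechet_derivative(2)[OF \<phi>])
  qed (rule assms(5))
  then show ?thesis
  proof (rule smooth_on_cong[OF _ open_U])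
    fix x assume "x \<in> U"
    note x = chart_inv_in[OF M c \<open>x \<in> U\<close>[unfolded U]]
    show "frechet_derivative ?\<phi> (at x) (V x c) = differential M N f (chart_inv c x) (V x) d"
      using differential_in_chart[OF V[OF \<open>x \<in> U\<close>], of c d] x c d
      by (simp add: map_deriv_def charts_at_def)
  qed
qed

text \<open>\<open>F\<close> stands for a 1-form or for one coordinate of a (1,1)-tensor. By
  linearity its value at \<open>W\<close> is the contraction of its smooth components, taken along
  \<open>f\<close>, with the smooth coordinates of \<open>W\<close>.\<close>

lemma smooth_on_components_along:
  fixes F :: "'b \<Rightarrow> ('b, 'f) tvec \<Rightarrow> 'z::real_normed_vector"
  assumes c: "c \<in> atlas M" and d: "d \<in> atlas N" and U: "U = snd c ` (fst c \<inter> f -` fst d)"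
    and lin: "\<And>q. q \<in> fst d \<Longrightarrow> linear_on_subspace (tangent_space N q) (F q)"
    and F: "\<And>e. smooth_on (\<lambda>y. F (chart_inv d y) (coord_vec N d e (chart_inv d y))) (snd d ` fst d)"
    and W: "\<And>x. x \<in> U \<Longrightarrow> W x \<in> tangent_space N (f (chart_inv c x))" and "smooth_on (\<lambda>x. W x d) U"
  shows "smooth_on (\<lambda>x. F (f (chart_inv c x)) (W x)) U"
proof -
  let ?\<phi> = "snd d \<circ> f \<circ> chart_inv c"
  let ?F = "\<lambda>y e. F (chart_inv d y) (coord_vec N d e (chart_inv d y))"
  have open_U: "open U" unfolding U by (rule open_chart_preimage[OF M N f c d])
  have \<phi>: "smooth_on ?\<phi> U" using f c d by (auto simp: smooth_map_def U)
  have x: "f (chart_inv c x) \<in> fst d" "chart_inv d (?\<phi> x) = f (chart_inv c x)" if "x \<in> U" for x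
    using chart_inv_in[OF M c that[unfolded U]] chart_inv_chart[OF N d] by auto
  have linF: "linear (?F (?\<phi> x))" if "x \<in> U" for x
  proof -
    have d': "d \<in> charts_at N (f (chart_inv c x))" using x[OF that] d by (simp add: charts_at_def)
    show ?thesis
      using linear_on_subspaceD[OF lin[OF x(1)[OF that]]] coord_vec_in_tangent_space[OF N d']
      by (intro linearI) (simp_all add: x[OF that, simplified] coord_vec_add_scaleR[OF N d'])
  qed
  have "smooth_on (\<lambda>x. ?F (?\<phi> x) (W x d)) U"
  proof (rule smooth_on_linear_apply[OF open_U linF])
    show "smooth_on (\<lambda>x. ?F (?\<phi> x) e) U" for e
      using x by (intro smooth_on_compose[OF open_U chart_homeomorphic(2)[OF N d] _ \<phi> F]) auto
    show "smooth_on (\<lambda>x. W x d) U" by (fact assms(7))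
  qed
  then show ?thesis
  proof (rule smooth_on_cong[OF _ open_U])
    show "?F (?\<phi> x) (W x d) = F (f (chart_inv c x)) (W x)" if "x \<in> U" for x
      using coord_vec_coordinates[OF N W[OF that], of d] x[OF that] d by (simp add: charts_at_def)
  qed
qed

text \<open>The charts of \<open>N\<close> cover the image of \<open>f\<close>, so their preimages
  cover the chart domain and smoothness is checked on each piece.\<close>

lemma smooth_on_chart_if_along:
  assumes c: "c \<in> atlas M"
    and "\<And>d. d \<in> atlas N \<Longrightarrow> smooth_on h (snd c ` (fst c \<inter> f -` fst d))"
  shows "smooth_on h (snd c ` fst c)"
proof (rule smooth_on_local)
  fix x assume x: "x \<in> snd c ` fst c"
  then obtain p where p: "x = snd c p" "p \<in> fst c" by auto
  then obtain d where "d \<in> charts_at N (f p)"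
    using charts_at_nonempty[OF N smooth_map_points[OF f]] chart_domain[OF M c] by blast
  then have d: "d \<in> atlas N" "f p \<in> fst d" by (auto simp: charts_at_def)
  then show "\<exists>U. open U \<and> x \<in> U \<and> smooth_on h U"
    using p assms(2) open_chart_preimage[OF M N f c]
    by (intro exI[of _ "snd c ` (fst c \<inter> f -` fst d)"]) auto
qed

end

subsection \<open>Riemannian hypersurfaces\<close>

lemma riemannian_metricD:
  assumes "riemannian_metric M g" "p \<in> points M" "v \<in> tangent_space M p"
  shows "w \<in> tangent_space M p \<Longrightarrow> g p v w = g p w v"
    and "v \<noteq> 0 \<Longrightarrow> g p v v > 0"
    and "w \<in> tangent_space M p \<Longrightarrow> w' \<in> tangent_space M p \<Longrightarrow> g p v (w + w') = g p v w + g p v w'"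
    and "w \<in> tangent_space M p \<Longrightarrow> g p v (r *\<^sub>R w) = r * g p v w"
proof -
  have *: "linear_on_subspace (tangent_space M p) (g p v) \<and>
      (\<forall>w\<in>tangent_space M p. g p v w = g p w v) \<and> (v \<noteq> 0 \<longrightarrow> g p v v > 0)"
    using assms unfolding riemannian_metric_def by blast
  then have lin: "linear_on_subspace (tangent_space M p) (g p v)" by blast
  show "g p v w = g p w v" if "w \<in> tangent_space M p" using * that by blast
  show "g p v v > 0" if "v \<noteq> 0" using * that by blast
  show "g p v (w + w') = g p v w + g p v w'" if "w \<in> tangent_space M p" "w' \<in> tangent_space M p"
    using linear_on_subspaceD(1)[OF lin that] .
  show "g p v (r *\<^sub>R w) = r * g p v w" if "w \<in> tangent_space M p"
    using linear_on_subspaceD(2)[OF lin that] by simp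
qed

lemma tensor_field_1_1D:
  assumes "tensor_field_1_1 M P" "p \<in> points M"
  shows "v \<in> tangent_space M p \<Longrightarrow> P p v \<in> tangent_space M p"
    and "linear_on_subspace (tangent_space M p) (P p)"
proof -
  have *: "P p ` tangent_space M p \<subseteq> tangent_space M p \<and> linear_on_subspace (tangent_space M p) (P p)"
    using assms unfolding tensor_field_1_1_def by blast
  show "P p v \<in> tangent_space M p" if "v \<in> tangent_space M p" using * that by blast
  show "linear_on_subspace (tangent_space M p) (P p)" using * by blast
qed

lemma vector_fieldsD: "X \<in> vector_fields M \<Longrightarrow> p \<in> points M \<Longrightarrow> X p \<in> tangent_space M p"
  by (simp add: vector_fields_def)

text \<open>One step of the tower; the theorem interprets it for \<open>M'\<close> in
  \<open>M''\<close> and for \<open>M\<close> in \<open>M'\<close>.\<close>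

locale riemannian_hypersurface =
  fixes M :: "('a, 'e::euclidean_space) manifold" and g
    and N :: "('b, 'f::euclidean_space) manifold" and h and f and \<nu>
  assumes M: "smooth_manifold M" and g: "riemannian_metric M g"
    and N: "smooth_manifold N" and h: "riemannian_metric N h"
    and codim: "DIM('f) = DIM('e) + 1"
    and immersion: "isometric_immersion M g N h f"
    and normal: "unit_normal_field M N h f \<nu>"
begin

abbreviation df :: "'a \<Rightarrow> ('a, 'e) tvec \<Rightarrow> ('b, 'f) tvec" where
  "df \<equiv> differential M N f"

lemma f: "smooth_map M N f"
  using immersion by (simp add: isometric_immersion_def)

lemmas M_sub = subspace_tangent_space[OF M]
lemmas N_sub = subspace_tangent_space[OF N]

context
  fixes p assumes p: "p \<in> points M"
begin

lemma fp: "f p \<in> points N"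
  by (rule smooth_map_points[OF f p])

lemma df_in: "v \<in> tangent_space M p \<Longrightarrow> df p v \<in> tangent_space N (f p)"
  by (rule differential_in_tangent_space[OF M N f _ p])

lemma df_add: "v \<in> tangent_space M p \<Longrightarrow> w \<in> tangent_space M p \<Longrightarrow> df p (v + w) = df p v + df p w"
  and df_scale: "v \<in> tangent_space M p \<Longrightarrow> df p (r *\<^sub>R v) = r *\<^sub>R df p v"
  using linear_on_subspaceD[OF linear_differential[OF M N f p]] by blast+

lemma df_inj: "v \<in> tangent_space M p \<Longrightarrow> w \<in> tangent_space M p \<Longrightarrow> df p v = df p w \<Longrightarrow> v = w"
  using immersion p unfolding isometric_immersion_def inj_on_def by blast

lemma df_isometry: "v \<in> tangent_space M p \<Longrightarrow> w \<in> tangent_space M p \<Longrightarrow> h (f p) (df p v) (df p w) = g p v w"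
  using immersion p unfolding isometric_immersion_def by blast

lemma normal_in: "\<nu> p \<in> tangent_space N (f p)"
  and normal_unit: "h (f p) (\<nu> p) (\<nu> p) = 1"
  and normal_orth: "v \<in> tangent_space M p \<Longrightarrow> h (f p) (df p v) (\<nu> p) = 0"
  using normal p unfolding unit_normal_field_def normal_space_def by blast+

lemmas h_sym = riemannian_metricD(1)[OF h fp]
lemmas h_add = riemannian_metricD(3)[OF h fp]
lemmas h_scale = riemannian_metricD(4)[OF h fp]

lemma split_in: "v \<in> tangent_space M p \<Longrightarrow> df p v + a *\<^sub>R \<nu> p \<in> tangent_space N (f p)"
  by (intro subspace_add[OF N_sub] subspace_scale[OF N_sub] df_in normal_in)

lemma inner_split_normal: "v \<in> tangent_space M p \<Longrightarrow> h (f p) (\<nu> p) (df p v + a *\<^sub>R \<nu> p) = a"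
  using h_sym[OF df_in normal_in] normal_orth normal_unit
  by (simp add: h_add h_scale df_in normal_in subspace_scale[OF N_sub])

lemma inner_split_tangent:
  assumes "v \<in> tangent_space M p" "w \<in> tangent_space M p"
  shows "h (f p) (df p w) (df p v + a *\<^sub>R \<nu> p) = g p w v"
  using assms by (simp add: h_add h_scale df_in normal_in subspace_scale[OF N_sub] normal_orth df_isometry)

text \<open>The product with the unit normal reads off the coefficient; injectivity of the
  differential gives the rest.\<close>

lemma split_unique:
  assumes v: "v \<in> tangent_space M p" and w: "w \<in> tangent_space M p"
    and eq: "df p v + a *\<^sub>R \<nu> p = df p w + b *\<^sub>R \<nu> p"
  shows "v = w" "a = b"
proof -
  show "a = b" using inner_split_normal[OF v] inner_split_normal[OF w] eq by metis
  with eq show "v = w" using df_inj[OF v w] by simp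
qed

text \<open>The system behind the splitting of an ambient vector, in coordinates. Codimension 1
  enters here, to make the numbers of unknowns and equations equal.\<close>

lemma linear_split_chart:
  assumes c: "c \<in> charts_at M p" and d: "d \<in> charts_at N (f p)"
  shows "linear (\<lambda>z. map_deriv f c d p (fst z) + snd z *\<^sub>R \<nu> p d)"
    and "inj (\<lambda>z. map_deriv f c d p (fst z) + snd z *\<^sub>R \<nu> p d)"
    and "surj (\<lambda>z. map_deriv f c d p (fst z) + snd z *\<^sub>R \<nu> p d)"
proof -
  let ?L = "\<lambda>z. map_deriv f c d p (fst z) + snd z *\<^sub>R \<nu> p d"
  note lin = linear_map_deriv[OF M N f c d]
  show L: "linear ?L"
    by (rule linearI) (simp_all add: linear_add[OF lin] linear_scale[OF lin] algebra_simps)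
  have "z = 0" if "?L z = 0" for z
  proof -
    let ?v = "coord_vec M c (fst z) p"
    note v = coord_vec_in_tangent_space[OF M c, of "fst z"]
    note zero = subspace_0[OF M_sub, of p]
    have df0: "df p 0 = 0" using df_scale[OF zero, of 0] by simp
    \<comment> \<open>A kernel element in coordinates is a splitting of the zero vector, hence
      trivial by uniqueness.\<close>
    have "df p ?v + snd z *\<^sub>R \<nu> p = df p 0 + 0 *\<^sub>R \<nu> p"
    proof (rule tangent_space_eqI[OF split_in split_in d])
      show "(df p ?v + snd z *\<^sub>R \<nu> p) d = (df p 0 + 0 *\<^sub>R \<nu> p) d"
        using that by (simp add: differential_in_chart[OF M N f v c d] coord_vec_self[OF M c] scaleR_fun_def df0)
    qed (use v zero in auto)
    from split_unique[OF v zero this] show ?thesis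
      using coord_vec_self[OF M c, of "fst z"] by (simp add: prod_eq_iff)
  qed
  then show inj: "inj ?L" using linear_injective_0[OF L] by blast
  \<comment> \<open>An injective linear map from the product of \<open>'e\<close> with the reals has
    range of dimension \<open>DIM('e) + 1\<close>, which is all of \<open>'f\<close>.\<close>
  have "dim (range ?L) = DIM('f)"
    using dim_image_eq[OF L] inj codim by simp
  then have "span (range ?L) = UNIV" by (simp only: dim_eq_full)
  moreover have "span (range ?L) = range ?L"
    using linear_subspace_image[OF L subspace_UNIV] by (simp only: span_eq_iff)
  ultimately show "surj ?L" by simp
qed

lemma split_exists:
  assumes z: "z \<in> tangent_space N (f p)"
  obtains v a where "v \<in> tangent_space M p" "z = df p v + a *\<^sub>R \<nu> p"
proof -
  obtain c where c: "c \<in> charts_at M p" using charts_at_nonempty[OF M p] by blast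
  obtain d where d: "d \<in> charts_at N (f p)" using charts_at_nonempty[OF N fp] by blast
  obtain y where y: "z d = map_deriv f c d p (fst y) + snd y *\<^sub>R \<nu> p d"
    using surjD[OF linear_split_chart(3)[OF c d], of "z d"] by blast
  note v = coord_vec_in_tangent_space[OF M c, of "fst y"]
  have "z = df p (coord_vec M c (fst y) p) + snd y *\<^sub>R \<nu> p"
    by (rule tangent_space_eqI[OF z split_in d])
      (simp_all add: y v differential_in_chart[OF M N f v c d] coord_vec_self[OF M c] scaleR_fun_def)
  with v that show thesis by blast
qed

end

section \<open>Tangential and normal components as functions\<close>

definition normal_part :: "'a \<Rightarrow> ('b, 'f) tvec \<Rightarrow> real" where
  "normal_part p z = h (f p) (\<nu> p) z"

text \<open>For tangent vectors of \<open>N\<close> along \<open>M\<close> the argument of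
  \<open>inv_into\<close> lies in the image of \<open>df p\<close>, by
  \<open>split_exists\<close>.\<close>

definition tangent_part :: "'a \<Rightarrow> ('b, 'f) tvec \<Rightarrow> ('a, 'e) tvec" where
  "tangent_part p z = inv_into (tangent_space M p) (df p) (z - normal_part p z *\<^sub>R \<nu> p)"

lemma parts_split:
  assumes p: "p \<in> points M" and v: "v \<in> tangent_space M p"
  shows "tangent_part p (df p v + a *\<^sub>R \<nu> p) = v" "normal_part p (df p v + a *\<^sub>R \<nu> p) = a"
proof -
  show a: "normal_part p (df p v + a *\<^sub>R \<nu> p) = a"
    using inner_split_normal[OF p v] by (simp add: normal_part_def)
  show "tangent_part p (df p v + a *\<^sub>R \<nu> p) = v"
    using df_inj[OF p] v by (simp add: tangent_part_def a inj_on_def)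
qed

lemma split_parts:
  assumes p: "p \<in> points M" and z: "z \<in> tangent_space N (f p)"
  shows "tangent_part p z \<in> tangent_space M p"
    and "df p (tangent_part p z) + normal_part p z *\<^sub>R \<nu> p = z"
  using split_exists[OF p z] parts_split[OF p] by metis+

text \<open>Adding or scaling splittings gives a splitting, and splittings are unique.\<close>

lemma linear_parts:
  assumes p: "p \<in> points M" and V: "subspace V" and T: "linear_on_subspace V T" "T ` V \<subseteq> tangent_space N (f p)"
  shows "linear_on_subspace V (\<lambda>X. tangent_part p (T X))"
    and "linear_on_subspace V (\<lambda>X. normal_part p (T X))"
proof -
  let ?t = "tangent_part p" and ?n = "normal_part p"
  have add: "?t (T v + T w) = ?t (T v) + ?t (T w)" "?n (T v + T w) = ?n (T v) + ?n (T w)"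
    if "v \<in> V" "w \<in> V" for v w
  proof -
    have *: "T v \<in> tangent_space N (f p)" "T w \<in> tangent_space N (f p)" using T that by auto
    note t = split_parts(1)[OF p *(1)] split_parts(1)[OF p *(2)]
    have "T v + T w = (df p (?t (T v)) + ?n (T v) *\<^sub>R \<nu> p) + (df p (?t (T w)) + ?n (T w) *\<^sub>R \<nu> p)"
      using split_parts(2)[OF p *(1)] split_parts(2)[OF p *(2)] by simp
    also have "\<dots> = df p (?t (T v) + ?t (T w)) + (?n (T v) + ?n (T w)) *\<^sub>R \<nu> p"
      by (simp add: df_add[OF p t] scaleR_add_left)
    finally show "?t (T v + T w) = ?t (T v) + ?t (T w)" "?n (T v + T w) = ?n (T v) + ?n (T w)"
      using parts_split[OF p subspace_add[OF M_sub t]] by simp_all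
  qed
  have scale: "?t (r *\<^sub>R T v) = r *\<^sub>R ?t (T v)" "?n (r *\<^sub>R T v) = r * ?n (T v)"
    if "v \<in> V" for v r
  proof -
    have *: "T v \<in> tangent_space N (f p)" using T that by auto
    note t = split_parts(1)[OF p *]
    have "r *\<^sub>R T v = r *\<^sub>R (df p (?t (T v)) + ?n (T v) *\<^sub>R \<nu> p)"
      using split_parts(2)[OF p *] by simp
    also have "\<dots> = df p (r *\<^sub>R ?t (T v)) + (r * ?n (T v)) *\<^sub>R \<nu> p"
      by (simp add: df_scale[OF p t] scaleR_add_right)
    finally show "?t (r *\<^sub>R T v) = r *\<^sub>R ?t (T v)" "?n (r *\<^sub>R T v) = r * ?n (T v)"
      using parts_split[OF p subspace_scale[OF M_sub t]] by simp_all
  qed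
  show "linear_on_subspace V (\<lambda>X. ?t (T X))" "linear_on_subspace V (\<lambda>X. ?n (T X))"
    using linear_on_subspaceD[OF T(1)] by (auto intro!: linear_on_subspaceI simp: add scale)
qed

section \<open>Smoothness of the components and existence of the induced objects\<close>

text \<open>A version of \<open>vector_fields_along\<close> confined to one chart, since the
  coordinate fields, on which tensor components are tested, live only on a chart domain.\<close>

definition smooth_along :: "('a, 'e) chart \<Rightarrow> ('a \<Rightarrow> ('b, 'f) tvec) \<Rightarrow> bool" where
  "smooth_along c W \<longleftrightarrow> (\<forall>q\<in>fst c. W q \<in> tangent_space N (f q)) \<and>
     (\<forall>d\<in>atlas N. smooth_on (\<lambda>x. W (chart_inv c x) d) (snd c ` (fst c \<inter> f -` fst d)))"

lemma smooth_along_vector_field: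
  assumes "W \<in> vector_fields_along M N f" "c \<in> atlas M"
  shows "smooth_along c W"
  using assms chart_domain(2)[OF M assms(2)] unfolding smooth_along_def vector_fields_along_def by blast

lemma smooth_along_tensor:
  assumes Q: "tensor_field_1_1 N Q" and c: "c \<in> atlas M" and W: "smooth_along c W"
  shows "smooth_along c (\<lambda>q. Q (f q) (W q))"
  unfolding smooth_along_def
proof (intro conjI ballI)
  show "Q (f q) (W q) \<in> tangent_space N (f q)" if "q \<in> fst c" for q
    using W chart_domain(2)[OF M c] that
    by (auto simp: smooth_along_def intro!: tensor_field_1_1D(1)[OF Q] fp)
  fix d assume d: "d \<in> atlas N"
  let ?U = "snd c ` (fst c \<inter> f -` fst d)"
  show "smooth_on (\<lambda>x. Q (f (chart_inv c x)) (W (chart_inv c x)) d) ?U"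
  proof (rule smooth_on_components_along[OF M N f c d refl, where F="\<lambda>q w. Q q w d"])
    show "linear_on_subspace (tangent_space N q) (\<lambda>w. Q q w d)" if "q \<in> fst d" for q
    proof -
      have "q \<in> points N" using chart_domain(2)[OF N d] that by blast
      note Q = tensor_field_1_1D(2)[OF Q this]
      show ?thesis
        by (rule linear_on_subspaceI) (simp_all add: linear_on_subspaceD[OF Q], simp add: scaleR_fun_def)
    qed
    show "smooth_on (\<lambda>y. Q (chart_inv d y) (coord_vec N d e (chart_inv d y)) d) (snd d ` fst d)" for e
      using Q d unfolding tensor_field_1_1_def by blast
    show "W (chart_inv c x) \<in> tangent_space N (f (chart_inv c x))" if "x \<in> ?U" for x
      using W chart_inv_in[OF M c that] by (simp add: smooth_along_def)
    show "smooth_on (\<lambda>x. W (chart_inv c x) d) ?U" using W d by (simp add: smooth_along_def)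
  qed
qed

lemma smooth_along_coordinate_field:
  assumes c: "c \<in> atlas M"
  shows "smooth_along c (\<lambda>q. df q (coord_vec M c e q))"
  unfolding smooth_along_def
proof (intro conjI ballI)
  have coord: "coord_vec M c e q \<in> tangent_space M q" if "q \<in> fst c" for q
    using coord_vec_in_tangent_space[OF M] c that by (simp add: charts_at_def)
  then show "df q (coord_vec M c e q) \<in> tangent_space N (f q)" if "q \<in> fst c" for q
    using df_in chart_domain(2)[OF M c] that by blast
  fix d assume d: "d \<in> atlas N"
  let ?U = "snd c ` (fst c \<inter> f -` fst d)"
  have open_U: "open ?U" by (rule open_chart_preimage[OF M N f c d])
  show "smooth_on (\<lambda>x. df (chart_inv c x) (coord_vec M c e (chart_inv c x)) d) ?U"
  proof (rule smooth_on_differential[OF M N f c d refl])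
    show "coord_vec M c e (chart_inv c x) \<in> tangent_space M (chart_inv c x)" if "x \<in> ?U" for x
      using coord chart_inv_in[OF M c that] by blast
    \<comment> \<open>In its own chart a coordinate field has the constant coordinates
      \<open>e\<close>.\<close>
    show "smooth_on (\<lambda>x. coord_vec M c e (chart_inv c x) c) ?U"
      by (rule smooth_on_cong[OF smooth_on_const[OF open_U, of e] open_U])
        (use chart_inv_in[OF M c] c in \<open>simp add: coord_vec_self[OF M] charts_at_def\<close>)
  qed
qed

lemma smooth_on_parts:
  assumes c: "c \<in> atlas M" and W: "smooth_along c W"
  shows "smooth_on (\<lambda>x. tangent_part (chart_inv c x) (W (chart_inv c x)) c) (snd c ` fst c)"
    and "smooth_on (\<lambda>x. normal_part (chart_inv c x) (W (chart_inv c x))) (snd c ` fst c)"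
proof -
  let ?t = "\<lambda>x. tangent_part (chart_inv c x) (W (chart_inv c x)) c"
  let ?n = "\<lambda>x. normal_part (chart_inv c x) (W (chart_inv c x))"
  \<comment> \<open>The two parts form a single unknown of one linear system; they are separated by
    the projections at the end.\<close>
  have *: "smooth_on (\<lambda>x. (?t x, ?n x)) (snd c ` fst c)"
  proof (rule smooth_on_chart_if_along[OF M N f c])
    fix d assume d: "d \<in> atlas N"
    let ?U = "snd c ` (fst c \<inter> f -` fst d)"
    let ?L = "\<lambda>x z. map_deriv f c d (chart_inv c x) (fst z) + snd z *\<^sub>R \<nu> (chart_inv c x) d"
    have open_U: "open ?U" by (rule open_chart_preimage[OF M N f c d])
    have U: "chart_inv c x \<in> points M" "c \<in> charts_at M (chart_inv c x)"
      "d \<in> charts_at N (f (chart_inv c x))" if "x \<in> ?U" for x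
      using chart_inv_in[OF M c that] c d chart_domain(2)[OF M c] by (auto simp: charts_at_def)
    have \<phi>: "smooth_on (snd d \<circ> f \<circ> chart_inv c) ?U"
      using f c d by (auto simp: smooth_map_def)
    show "smooth_on (\<lambda>x. (?t x, ?n x)) ?U"
    proof (rule smooth_on_linear_solve[where L="?L" and w="\<lambda>x. W (chart_inv c x) d", OF open_U])
      show "linear (?L x)" "inj (?L x)" if "x \<in> ?U" for x
        using linear_split_chart[OF U[OF that]] by blast+
      show "smooth_on (\<lambda>x. W (chart_inv c x) d) ?U" using W d by (simp add: smooth_along_def)
      show "smooth_on (\<lambda>x. ?L x z) ?U" for z
      proof (intro smooth_on_add[OF open_U] smooth_on_scaleR[OF open_U smooth_on_const[OF open_U]])
        show "smooth_on (\<lambda>x. \<nu> (chart_inv c x) d) ?U"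
          using normal c d unfolding unit_normal_field_def vector_fields_along_def by blast
        show "smooth_on (\<lambda>x. map_deriv f c d (chart_inv c x) (fst z)) ?U"
          by (rule smooth_on_cong[OF smooth_on_frechet_derivative(2)[OF \<phi>] open_U])
            (use chart_inv_in[OF M c] in \<open>simp add: map_deriv_def\<close>)
      qed
      show "?L x (?t x, ?n x) = W (chart_inv c x) d" if x: "x \<in> ?U" for x
      proof -
        have "W (chart_inv c x) \<in> tangent_space N (f (chart_inv c x))"
          using W chart_inv_in[OF M c x] by (simp add: smooth_along_def)
        note split = split_parts[OF U(1)[OF x] this]
        show ?thesis
          using fun_cong[OF split(2), of d] differential_in_chart[OF M N f split(1) U(2,3)[OF x]]
          by (simp add: scaleR_fun_def)
      qed
    qed
  qed
  show "smooth_on ?t (snd c ` fst c)" "smooth_on ?n (snd c ` fst c)"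
    using smooth_on_bounded_linear[OF bounded_linear_fst chart_homeomorphic(2)[OF M c] *]
      smooth_on_bounded_linear[OF bounded_linear_snd chart_homeomorphic(2)[OF M c] *] by simp_all
qed

lemma tangent_part_vector_field:
  assumes "W \<in> vector_fields_along M N f"
  shows "(\<lambda>p. tangent_part p (W p)) \<in> vector_fields M"
    and "smooth_fun M (\<lambda>p. normal_part p (W p))"
  using assms smooth_on_parts[OF _ smooth_along_vector_field[OF assms]] split_parts(1)
  by (simp_all add: vector_fields_def smooth_fun_def vector_fields_along_def o_def)

lemma tensor_along_vector_field:
  assumes Q: "tensor_field_1_1 N Q" and W: "W \<in> vector_fields_along M N f"
  shows "(\<lambda>p. Q (f p) (W p)) \<in> vector_fields_along M N f"
proof -
  have "smooth_along c (\<lambda>p. Q (f p) (W p))" if "c \<in> atlas M" for c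
    by (intro smooth_along_tensor[OF Q that] smooth_along_vector_field[OF W that])
  moreover have "Q (f p) (W p) \<in> tangent_space N (f p)" if "p \<in> points M" for p
    using W that by (intro tensor_field_1_1D(1)[OF Q] fp) (simp_all add: vector_fields_along_def)
  ultimately show ?thesis by (simp add: vector_fields_along_def smooth_along_def)
qed

lemma hypersurface_decomposition_exists:
  assumes Q: "tensor_field_1_1 N Q"
  shows "hypersurface_decomposition M N f \<nu> Q
    (\<lambda>p X. tangent_part p (Q (f p) (df p X))) (\<lambda>p X. normal_part p (Q (f p) (df p X)))
    (\<lambda>p. tangent_part p (Q (f p) (\<nu> p))) (\<lambda>p. normal_part p (Q (f p) (\<nu> p)))"
proof -
  have \<nu>: "\<nu> \<in> vector_fields_along M N f" using normal by (simp add: unit_normal_field_def)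
  have Q_df: "Q (f p) (df p X) \<in> tangent_space N (f p)"
    if "p \<in> points M" "X \<in> tangent_space M p" for p X
    by (intro tensor_field_1_1D(1)[OF Q] fp df_in that)
  have lin: "linear_on_subspace (tangent_space M p) (\<lambda>X. Q (f p) (df p X))" if p: "p \<in> points M" for p
    by (rule linear_on_subspaceI)
      (simp_all add: df_add[OF p] df_scale[OF p] linear_on_subspaceD[OF tensor_field_1_1D(2)[OF Q fp[OF p]] df_in[OF p]] df_in[OF p])
  have lin_parts: "linear_on_subspace (tangent_space M p) (\<lambda>X. tangent_part p (Q (f p) (df p X)))"
    "linear_on_subspace (tangent_space M p) (\<lambda>X. normal_part p (Q (f p) (df p X)))"
    if p: "p \<in> points M" for p
    using linear_parts[OF p M_sub lin[OF p]] Q_df[OF p] by blast+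
  note coord = smooth_on_parts[OF _ smooth_along_tensor[OF Q _ smooth_along_coordinate_field]]
  show ?thesis
    unfolding hypersurface_decomposition_def
  proof (intro conjI ballI)
    show "tensor_field_1_1 M (\<lambda>p X. tangent_part p (Q (f p) (df p X)))"
      using split_parts(1) Q_df lin_parts coord by (auto simp: tensor_field_1_1_def)
    show "one_form M (\<lambda>p X. normal_part p (Q (f p) (df p X)))"
      using lin_parts coord by (simp add: one_form_def)
  qed (use tangent_part_vector_field[OF tensor_along_vector_field[OF Q \<nu>]] split_parts(2) Q_df
      tensor_field_1_1D(1)[OF Q fp normal_in] in auto)
qed

text \<open>Makes the restriction of \<open>u2'\<close> to \<open>M\<close> a 1-form.\<close>

lemma pullback_one_form:
  assumes u: "one_form N u"
  shows "one_form M (\<lambda>p X. u (f p) (df p X))"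
  unfolding one_form_def
proof (intro conjI ballI allI)
  have lin: "linear_on_subspace (tangent_space N q) (u q)" if "q \<in> points N" for q
    using u that by (simp add: one_form_def)
  show "linear_on_subspace (tangent_space M p) (\<lambda>X. u (f p) (df p X))" if p: "p \<in> points M" for p
    by (rule linear_on_subspaceI)
      (simp_all add: df_add[OF p] df_scale[OF p] linear_on_subspaceD[OF lin[OF fp[OF p]] df_in[OF p]] df_in[OF p])
  fix c e assume c: "c \<in> atlas M"
  note coord = smooth_along_coordinate_field[OF c, of e, unfolded smooth_along_def]
  show "smooth_on (\<lambda>x. u (f (chart_inv c x)) (df (chart_inv c x) (coord_vec M c e (chart_inv c x)))) (snd c ` fst c)"
  proof (rule smooth_on_chart_if_along[OF M N f c])
    fix d assume d: "d \<in> atlas N"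
    show "smooth_on (\<lambda>x. u (f (chart_inv c x)) (df (chart_inv c x) (coord_vec M c e (chart_inv c x))))
        (snd c ` (fst c \<inter> f -` fst d))"
    proof (rule smooth_on_components_along[OF M N f c d refl, where F=u
          and W="\<lambda>x. df (chart_inv c x) (coord_vec M c e (chart_inv c x))"])
      show "linear_on_subspace (tangent_space N q) (u q)" if "q \<in> fst d" for q
        using lin chart_domain(2)[OF N d] that by blast
      show "smooth_on (\<lambda>y. u (chart_inv d y) (coord_vec N d e (chart_inv d y))) (snd d ` fst d)" for e
        using u d by (simp add: one_form_def)
    qed (use coord d chart_inv_in[OF M c] in auto)
  qed
qed

lemma restrict_vector_field:
  assumes Z: "Z \<in> vector_fields N"
  shows "(\<lambda>p. Z (f p)) \<in> vector_fields_along M N f"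
  unfolding vector_fields_along_def
proof (intro CollectI conjI ballI)
  show "Z (f p) \<in> tangent_space N (f p)" if "p \<in> points M" for p
    by (rule vector_fieldsD[OF Z fp[OF that]])
  fix c d assume c: "c \<in> atlas M" and d: "d \<in> atlas N"
  let ?U = "snd c ` (fst c \<inter> f -` fst d)"
  have open_U: "open ?U" by (rule open_chart_preimage[OF M N f c d])
  have "smooth_on (\<lambda>x. (\<lambda>y. Z (chart_inv d y) d) ((snd d \<circ> f \<circ> chart_inv c) x)) ?U"
  proof (rule smooth_on_compose[where f="snd d \<circ> f \<circ> chart_inv c", OF open_U chart_homeomorphic(2)[OF N d]])
    show "smooth_on (snd d \<circ> f \<circ> chart_inv c) ?U" using f c d by (auto simp: smooth_map_def)
    show "smooth_on (\<lambda>y. Z (chart_inv d y) d) (snd d ` fst d)" using Z d by (simp add: vector_fields_def)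
  qed (auto simp: chart_inv_chart[OF M c])
  then show "smooth_on (\<lambda>x. Z (f (chart_inv c x)) d) ?U"
    by (rule smooth_on_cong[OF _ open_U]) (auto simp: chart_inv_chart[OF M c] chart_inv_chart[OF N d])
qed

lemma restrict_smooth_fun:
  assumes a: "smooth_fun N a"
  shows "smooth_fun M (\<lambda>p. a (f p))"
  unfolding smooth_fun_def
proof (intro ballI smooth_on_chart_if_along[OF M N f])
  fix c d assume c: "c \<in> atlas M" and d: "d \<in> atlas N"
  let ?U = "snd c ` (fst c \<inter> f -` fst d)"
  have open_U: "open ?U" by (rule open_chart_preimage[OF M N f c d])
  have "smooth_on (\<lambda>x. (a \<circ> chart_inv d) ((snd d \<circ> f \<circ> chart_inv c) x)) ?U"
  proof (rule smooth_on_compose[where f="snd d \<circ> f \<circ> chart_inv c", OF open_U chart_homeomorphic(2)[OF N d]])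
    show "smooth_on (snd d \<circ> f \<circ> chart_inv c) ?U" using f c d by (auto simp: smooth_map_def)
    show "smooth_on (a \<circ> chart_inv d) (snd d ` fst d)" using a d by (simp add: smooth_fun_def)
  qed (auto simp: chart_inv_chart[OF M c])
  then show "smooth_on ((\<lambda>p. a (f p)) \<circ> chart_inv c) ?U"
    by (rule smooth_on_cong[OF _ open_U]) (auto simp: chart_inv_chart[OF M c] chart_inv_chart[OF N d])
qed

section \<open>Pointwise algebra of the induced structure\<close>

context
  fixes Q P u \<xi> a p
  assumes decomposition: "hypersurface_decomposition M N f \<nu> Q P u \<xi> a"
    and Q: "tensor_field_1_1 N Q" and p: "p \<in> points M"
begin

lemma decomposition_in:
  shows "X \<in> tangent_space M p \<Longrightarrow> P p X \<in> tangent_space M p" "\<xi> p \<in> tangent_space M p"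
  using decomposition p
  by (auto simp: hypersurface_decomposition_def intro: tensor_field_1_1D vector_fieldsD)

lemma decomposition_df: "X \<in> tangent_space M p \<Longrightarrow> Q (f p) (df p X) = df p (P p X) + u p X *\<^sub>R \<nu> p"
  and decomposition_normal: "Q (f p) (\<nu> p) = df p (\<xi> p) + a p *\<^sub>R \<nu> p"
  using decomposition p unfolding hypersurface_decomposition_def by blast+

text \<open>The rule for a vector with both components. It allows \<open>Q\<close> to be applied a
  second time, and to be applied to \<open>\<eta>\<close>.\<close>

lemma decomposition_split:
  assumes X: "X \<in> tangent_space M p"
  shows "Q (f p) (df p X + r *\<^sub>R \<nu> p) = df p (P p X + r *\<^sub>R \<xi> p) + (u p X + r * a p) *\<^sub>R \<nu> p"
proof -
  note lin = linear_on_subspaceD[OF tensor_field_1_1D(2)[OF Q fp[OF p]]]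
  have "Q (f p) (df p X + r *\<^sub>R \<nu> p) = Q (f p) (df p X) + r *\<^sub>R Q (f p) (\<nu> p)"
    by (simp add: lin df_in[OF p X] normal_in[OF p] subspace_scale[OF N_sub])
  also have "\<dots> = (df p (P p X) + u p X *\<^sub>R \<nu> p) + r *\<^sub>R (df p (\<xi> p) + a p *\<^sub>R \<nu> p)"
    using decomposition_df[OF X] decomposition_normal by simp
  also have "\<dots> = df p (P p X + r *\<^sub>R \<xi> p) + (u p X + r * a p) *\<^sub>R \<nu> p"
    by (simp add: df_add[OF p] df_scale[OF p] decomposition_in X subspace_scale[OF M_sub]
        scaleR_add_left scaleR_add_right)
  finally show ?thesis .
qed

lemma decomposition_square:
  shows "X \<in> tangent_space M p \<Longrightarrow> Q (f p) (Q (f p) (df p X)) =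
      df p (P p (P p X) + u p X *\<^sub>R \<xi> p) + (u p (P p X) + u p X * a p) *\<^sub>R \<nu> p"
    and "Q (f p) (Q (f p) (\<nu> p)) =
      df p (P p (\<xi> p) + a p *\<^sub>R \<xi> p) + (u p (\<xi> p) + a p * a p) *\<^sub>R \<nu> p"
  by (simp_all add: decomposition_df decomposition_normal decomposition_split decomposition_in)

text \<open>Self-adjointness of \<open>Q\<close> tested on a tangent vector and the normal gives the
  first claim, tested on two tangent vectors the second.\<close>

lemma decomposition_symmetric:
  assumes sym: "\<And>U V. U \<in> tangent_space N (f p) \<Longrightarrow> V \<in> tangent_space N (f p) \<Longrightarrow>
      h (f p) (Q (f p) U) V = h (f p) U (Q (f p) V)"
    and X: "X \<in> tangent_space M p"
  shows "u p X = g p X (\<xi> p)" "Y \<in> tangent_space M p \<Longrightarrow> g p (P p X) Y = g p X (P p Y)"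
proof -
  note QX = decomposition_split[OF X, of 0, simplified]
  note h = inner_split_normal[OF p] inner_split_tangent[OF p] h_sym[OF p] df_in[OF p] normal_in[OF p]
    split_in[OF p] X decomposition_in
  have "u p X = h (f p) (\<nu> p) (Q (f p) (df p X))"
    by (simp add: QX h)
  also have "\<dots> = h (f p) (df p X) (Q (f p) (\<nu> p))"
    using sym[OF df_in[OF p X] normal_in[OF p]] h_sym[OF p normal_in[OF p], of "Q (f p) (df p X)"]
    by (simp add: QX h)
  also have "\<dots> = g p X (\<xi> p)" by (simp add: decomposition_normal h)
  finally show "u p X = g p X (\<xi> p)" .
  assume Y: "Y \<in> tangent_space M p"
  have "g p (P p X) Y = g p Y (P p X)"
    using riemannian_metricD(1)[OF g p] X Y decomposition_in by blast
  also have "\<dots> = h (f p) (df p Y) (Q (f p) (df p X))" by (simp add: QX h Y)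
  also have "\<dots> = h (f p) (df p X) (Q (f p) (df p Y))"
    using sym[OF df_in[OF p X] df_in[OF p Y]] h_sym[OF p df_in[OF p Y], of "Q (f p) (df p X)"]
    by (simp add: QX h)
  also have "\<dots> = g p X (P p Y)" by (simp add: decomposition_df h Y)
  finally show "g p (P p X) Y = g p X (P p Y)" .
qed

text \<open>\<open>\<zeta>\<close> and \<open>c\<close> are the tangential and normal parts of the
  field inherited from the ambient level; in the second step they are \<open>\<xi>2T\<close> and the
  entry \<open>a $ 1 $ 2\<close>. The 1-form \<open>u2\<close> appears as the product with
  \<open>\<zeta>\<close>, so that the lemma mentions only one decomposition.\<close>

lemma decomposition_identities:
  assumes sym: "\<And>U V. U \<in> tangent_space N (f p) \<Longrightarrow> V \<in> tangent_space N (f p) \<Longrightarrow>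
      h (f p) (Q (f p) U) V = h (f p) U (Q (f p) V)"
    and square: "\<And>Z. Z \<in> tangent_space N (f p) \<Longrightarrow> Q (f p) (Q (f p) Z) = Z - h (f p) Z \<eta> *\<^sub>R \<eta>"
    and Q_\<eta>: "Q (f p) \<eta> = - b *\<^sub>R \<eta>" and norm_\<eta>: "h (f p) \<eta> \<eta> = 1 - b\<^sup>2"
    and \<zeta>: "\<zeta> \<in> tangent_space M p" and \<eta>: "\<eta> = df p \<zeta> + c *\<^sub>R \<nu> p"
  shows "u p (\<xi> p) = 1 - (a p)\<^sup>2 - c\<^sup>2"
    and "g p (\<xi> p) \<zeta> = - a p * c - c * b"
    and "u p \<zeta> = - a p * c - c * b"
    and "g p \<zeta> \<zeta> = 1 - c\<^sup>2 - b\<^sup>2"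
    and "P p (\<xi> p) = - a p *\<^sub>R \<xi> p - c *\<^sub>R \<zeta>"
    and "P p \<zeta> = - c *\<^sub>R \<xi> p - b *\<^sub>R \<zeta>"
    and "X \<in> tangent_space M p \<Longrightarrow> P p (P p X) = X - u p X *\<^sub>R \<xi> p - g p X \<zeta> *\<^sub>R \<zeta>"
    and "X \<in> tangent_space M p \<Longrightarrow> u p (P p X) = - a p * u p X - c * g p X \<zeta>"
    and "X \<in> tangent_space M p \<Longrightarrow> g p (P p X) \<zeta> = - c * u p X - b * g p X \<zeta>"
    and "X \<in> tangent_space M p \<Longrightarrow> Y \<in> tangent_space M p \<Longrightarrow>
      g p (P p X) (P p Y) = g p X Y - u p X * u p Y - g p X \<zeta> * g p Y \<zeta>"
proof -
  note in_M = decomposition_in \<zeta> subspace_add[OF M_sub] subspace_scale[OF M_sub] subspace_diff[OF M_sub]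
  note in_N = df_in[OF p] normal_in[OF p] split_in[OF p]
  note g_add = riemannian_metricD(3)[OF g p] and g_scale = riemannian_metricD(4)[OF g p]
  have u_eq: "u p X = g p X (\<xi> p)" if "X \<in> tangent_space M p" for X
    by (rule decomposition_symmetric(1)[OF sym that])
  have P_sym: "g p (P p X) Y = g p X (P p Y)" if "X \<in> tangent_space M p" "Y \<in> tangent_space M p" for X Y
    by (rule decomposition_symmetric(2)[OF sym that])
  have \<eta>_in: "\<eta> \<in> tangent_space N (f p)" using split_in[OF p \<zeta>] by (simp add: \<eta>)
  have df_scaled: "df p (r *\<^sub>R X) = r *\<^sub>R df p X" "df p (X - r *\<^sub>R Y) = df p X - r *\<^sub>R df p Y"
    if "X \<in> tangent_space M p" "Y \<in> tangent_space M p" for X Y r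
    using df_add[OF p that(1) in_M(5)[OF that(2), where c="- r"]] df_scale[OF p that(1)] df_scale[OF p that(2), of "- r"]
    by simp_all
  \<comment> \<open>The product with \<open>\<eta>\<close> in terms of components; it evaluates the
    rank one term and every contraction with \<open>\<zeta>\<close> below.\<close>
  have inner_\<eta>: "h (f p) (df p X + r *\<^sub>R \<nu> p) \<eta> = g p X \<zeta> + r * c" if X: "X \<in> tangent_space M p" for X r
  proof -
    have "h (f p) (df p X + r *\<^sub>R \<nu> p) \<eta> = h (f p) \<eta> (df p X + r *\<^sub>R \<nu> p)"
      using h_sym[OF p \<eta>_in split_in[OF p X, of r]] by simp
    also have "\<dots> = h (f p) \<eta> (df p X) + r * h (f p) \<eta> (\<nu> p)"
      by (simp add: h_add[OF p \<eta>_in] h_scale[OF p \<eta>_in] in_N X subspace_scale[OF N_sub])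
    also have "\<dots> = h (f p) (df p X) \<eta> + r * h (f p) (\<nu> p) \<eta>"
      using h_sym[OF p \<eta>_in df_in[OF p X]] h_sym[OF p \<eta>_in normal_in[OF p]] by simp
    also have "\<dots> = g p X \<zeta> + r * c"
      by (simp add: \<eta> inner_split_tangent[OF p \<zeta> X] inner_split_normal[OF p \<zeta>])
    finally show ?thesis .
  qed
  note inner_df = inner_\<eta>[of _ 0, simplified]
  have inner_normal: "h (f p) (\<nu> p) \<eta> = c" by (simp add: \<eta> inner_split_normal[OF p \<zeta>])
  \<comment> \<open>Self-adjointness moves \<open>Q\<close> onto its eigenvector
    \<open>\<eta>\<close>. With \<open>Z = df p X\<close> and \<open>Z = \<nu> p\<close> this yields
    the products of \<open>P p X\<close> and of \<open>\<xi> p\<close> with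
    \<open>\<zeta>\<close>.\<close>
  have inner_Q: "h (f p) (Q (f p) Z) \<eta> = - b * h (f p) Z \<eta>" if "Z \<in> tangent_space N (f p)" for Z
    using sym[OF that \<eta>_in] h_scale[OF p that \<eta>_in, of "- b"] by (simp add: Q_\<eta>)
  have move: "x = - y - z" if "x + y = - z" for x y z :: "('a, 'e) tvec"
    using that by (metis add_diff_cancel_right' minus_diff_commute)

  show PPX: "P p (P p X) = X - u p X *\<^sub>R \<xi> p - g p X \<zeta> *\<^sub>R \<zeta>"
    and "u p (P p X) = - a p * u p X - c * g p X \<zeta>"
    and "g p (P p X) \<zeta> = - c * u p X - b * g p X \<zeta>"
    if X: "X \<in> tangent_space M p" for X
  proof -
    \<comment> \<open>Both sides are \<open>Q\<^sup>2\<close> at \<open>df p X\<close>. The rank one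
      term contributes through both parts of \<open>\<eta>\<close>, giving the summands with
      \<open>\<zeta>\<close> and with \<open>c\<close>.\<close>
    have "df p (P p (P p X) + u p X *\<^sub>R \<xi> p) + (u p (P p X) + u p X * a p) *\<^sub>R \<nu> p
        = df p (X - g p X \<zeta> *\<^sub>R \<zeta>) + (- (g p X \<zeta> * c)) *\<^sub>R \<nu> p"
      using square[OF df_in[OF p X]] decomposition_square(1)[OF X]
      by (simp add: inner_df X df_scaled \<zeta>) (simp add: \<eta> scaleR_add_right)
    from split_unique[OF p _ _ this]
    show "P p (P p X) = X - u p X *\<^sub>R \<xi> p - g p X \<zeta> *\<^sub>R \<zeta>"
      and "u p (P p X) = - a p * u p X - c * g p X \<zeta>"
      by (simp_all add: in_M X algebra_simps)
    show "g p (P p X) \<zeta> = - c * u p X - b * g p X \<zeta>"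
      using inner_Q[OF df_in[OF p X]]
      by (simp add: decomposition_df X inner_\<eta> inner_df in_M) (simp add: algebra_simps)
  qed
  \<comment> \<open>The same comparison at the normal, whose product with \<open>\<eta>\<close> is
    \<open>c\<close>.\<close>
  have "df p (P p (\<xi> p) + a p *\<^sub>R \<xi> p) + (u p (\<xi> p) + a p * a p) *\<^sub>R \<nu> p
      = \<nu> p - c *\<^sub>R \<eta>"
    using square[OF normal_in[OF p]] decomposition_square(2) by (simp add: inner_normal)
  also have "\<dots> = df p (- c *\<^sub>R \<zeta>) + (1 - c * c) *\<^sub>R \<nu> p"
    by (simp add: df_scale[OF p \<zeta>, of "- c", simplified] \<eta> algebra_simps)
  finally have "df p (P p (\<xi> p) + a p *\<^sub>R \<xi> p) + (u p (\<xi> p) + a p * a p) *\<^sub>R \<nu> p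
      = df p (- c *\<^sub>R \<zeta>) + (1 - c * c) *\<^sub>R \<nu> p" .
  from split_unique[OF p _ _ this]
  show "P p (\<xi> p) = - a p *\<^sub>R \<xi> p - c *\<^sub>R \<zeta>" and "u p (\<xi> p) = 1 - (a p)\<^sup>2 - c\<^sup>2"
    using move[of "P p (\<xi> p)" "a p *\<^sub>R \<xi> p" "c *\<^sub>R \<zeta>"]
    by (simp_all add: in_M in_M(5)[where c="- c", simplified] power2_eq_square)
  show "g p (\<xi> p) \<zeta> = - a p * c - c * b"
    using inner_Q[OF normal_in[OF p]]
    by (simp add: decomposition_normal inner_\<eta> inner_normal in_M) (simp add: algebra_simps)
  \<comment> \<open>For \<open>X = \<zeta>\<close> and \<open>r = c\<close> the vector in
    \<open>inner_\<eta>\<close> is \<open>\<eta>\<close> itself, so this is Pythagoras.\<close>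
  show "g p \<zeta> \<zeta> = 1 - c\<^sup>2 - b\<^sup>2"
    using inner_\<eta>[OF \<zeta>, of c] norm_\<eta> by (simp add: \<eta>[symmetric] power2_eq_square)
  \<comment> \<open>The eigenvector equation for \<open>\<eta>\<close>, written in components on
    both sides.\<close>
  have "df p (P p \<zeta> + c *\<^sub>R \<xi> p) + (u p \<zeta> + c * a p) *\<^sub>R \<nu> p = df p (- b *\<^sub>R \<zeta>) + (- (b * c)) *\<^sub>R \<nu> p"
    using Q_\<eta> decomposition_split[OF \<zeta>, of c]
    by (simp add: \<eta>[symmetric]) (simp add: \<eta> df_scale[OF p \<zeta>, of "- b", simplified] scaleR_add_right)
  from split_unique[OF p _ _ this]
  show "P p \<zeta> = - c *\<^sub>R \<xi> p - b *\<^sub>R \<zeta>" and "u p \<zeta> = - a p * c - c * b"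
    using move[of "P p \<zeta>" "c *\<^sub>R \<xi> p" "b *\<^sub>R \<zeta>"]
    by (simp_all add: in_M in_M(5)[where c="- b", simplified] algebra_simps)
  assume X: "X \<in> tangent_space M p" and Y: "Y \<in> tangent_space M p"
  \<comment> \<open>The metric identity is the formula for \<open>P\<^sup>2\<close> paired with
    \<open>X\<close>.\<close>
  have "g p (P p X) (P p Y) = g p X (P p (P p Y))" using P_sym[OF X in_M(1)[OF Y]] .
  also have "P p (P p Y) = Y + (- u p Y) *\<^sub>R \<xi> p + (- g p Y \<zeta>) *\<^sub>R \<zeta>" using PPX[OF Y] by simp
  also have "g p X \<dots> = g p X Y + (- u p Y) * g p X (\<xi> p) + (- g p Y \<zeta>) * g p X \<zeta>"
    using X Y by (simp only: g_add g_scale in_M)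
  finally show "g p (P p X) (P p Y) = g p X Y - u p X * u p Y - g p X \<zeta> * g p Y \<zeta>"
    using u_eq[OF X] by simp
qed

end

end

subsection \<open>Hypersurfaces of hypersurfaces\<close>

lemma smooth_fun_2_2:
  assumes "smooth_fun M (\<lambda>p. a p $ 1 $ 1)" "smooth_fun M (\<lambda>p. a p $ 1 $ 2)"
    "smooth_fun M (\<lambda>p. a p $ 2 $ 1)" "smooth_fun M (\<lambda>p. a p $ 2 $ 2)"
  shows "smooth_fun M (\<lambda>p. (a p :: real^2^2) $ \<alpha> $ \<beta>)"
  using assms exhaust_2[of \<alpha>] exhaust_2[of \<beta>] by auto

text \<open>To be induced means two things here: the objects exist as smooth fields, and every tuple
  satisfying the defining decompositions has the listed properties. The second part argues from the
  decompositions alone, without reference to the constructed witnesses.\<close>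

theorem theorem5p1:
  fixes M :: "('a, 'e::euclidean_space) manifold"
    and M' :: "('b, 'f::euclidean_space) manifold"
    and M'' :: "('c, 'h::euclidean_space) manifold"
    and f :: "'a \<Rightarrow> 'b" and f' :: "'b \<Rightarrow> 'c"
  assumes "almost_product_riemannian M'' g'' P''"
    and "riemannian_manifold M' g'" and "DIM('h) = DIM('f) + 1"
    and "isometric_immersion M' g' M'' g'' f'" and "unit_normal_field M' M'' g'' f' N2"
    and "riemannian_manifold M g" and "DIM('f) = DIM('e) + 1"
    and "isometric_immersion M g M' g' f" and "unit_normal_field M M' g' f N1"
    and "hypersurface_decomposition M' M'' f' N2 P'' P' u2' \<xi>2' a22'"
  shows "(\<exists>P u1 u2 \<xi>1 \<xi>2T a.
            induced_structure M M' g' M'' g'' f f' N1 P' u2' \<xi>2' a22' P u1 u2 \<xi>1 \<xi>2T a) \<and>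
         (\<forall>P u1 u2 \<xi>1 \<xi>2T a.
            induced_structure M M' g' M'' g'' f f' N1 P' u2' \<xi>2' a22' P u1 u2 \<xi>1 \<xi>2T a \<longrightarrow>
            (\<forall>X\<in>vector_fields M. \<forall>Y\<in>vector_fields M. \<forall>p\<in>points M.
               P p (P p (X p)) = X p - u1 p (X p) *\<^sub>R \<xi>1 p - u2 p (X p) *\<^sub>R \<xi>2T p \<and>
               u1 p (P p (X p)) = - (a p $ 1 $ 1) * u1 p (X p) - a p $ 1 $ 2 * u2 p (X p) \<and>
               u2 p (P p (X p)) = - (a p $ 2 $ 1) * u1 p (X p) - a p $ 2 $ 2 * u2 p (X p) \<and>
               u1 p (\<xi>1 p) = 1 - (a p $ 1 $ 1)\<^sup>2 - (a p $ 1 $ 2)\<^sup>2 \<and>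
               u2 p (\<xi>1 p) = - (a p $ 1 $ 1) * a p $ 1 $ 2 - a p $ 1 $ 2 * a p $ 2 $ 2 \<and>
               u1 p (\<xi>2T p) = - (a p $ 1 $ 1) * a p $ 1 $ 2 - a p $ 1 $ 2 * a p $ 2 $ 2 \<and>
               u2 p (\<xi>2T p) = 1 - (a p $ 1 $ 2)\<^sup>2 - (a p $ 2 $ 2)\<^sup>2 \<and>
               P p (\<xi>1 p) = - (a p $ 1 $ 1) *\<^sub>R \<xi>1 p - a p $ 1 $ 2 *\<^sub>R \<xi>2T p \<and>
               P p (\<xi>2T p) = - (a p $ 1 $ 2) *\<^sub>R \<xi>1 p - a p $ 2 $ 2 *\<^sub>R \<xi>2T p \<and>
               u1 p (X p) = g p (X p) (\<xi>1 p) \<and>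
               u2 p (X p) = g p (X p) (\<xi>2T p) \<and>
               g p (P p (X p)) (Y p) = g p (X p) (P p (Y p)) \<and>
               g p (P p (X p)) (P p (Y p)) =
                 g p (X p) (Y p) - u1 p (X p) * u1 p (Y p) - u2 p (X p) * u2 p (Y p)))"
proof -
  note almost_product = assms(1)[unfolded almost_product_riemannian_def riemannian_manifold_def]
  interpret H: riemannian_hypersurface M' g' M'' g'' f' N2
    using almost_product assms by unfold_locales (auto simp: riemannian_manifold_def)
  interpret K: riemannian_hypersurface M g M' g' f N1
    using assms by unfold_locales (auto simp: riemannian_manifold_def)
  note induced = assms(10)
  have P'': "tensor_field_1_1 M'' P''" using almost_product by blast
  have P': "tensor_field_1_1 M' P'" and u2': "one_form M' u2'" and \<xi>2': "\<xi>2' \<in> vector_fields M'"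
    and a22': "smooth_fun M' a22'"
    using induced by (auto simp: hypersurface_decomposition_def)
  have involution: "P'' q (P'' q U) = U"
    and isometry: "V \<in> tangent_space M'' q \<Longrightarrow> g'' q (P'' q U) (P'' q V) = g'' q U V"
    if "q \<in> points M''" "U \<in> tangent_space M'' q" for q U V
    using almost_product that by blast+
  \<comment> \<open>Apply the isometry property to \<open>U\<close> and \<open>P'' q V\<close>, then
    the involution.\<close>
  have symmetric: "g'' q (P'' q U) V = g'' q U (P'' q V)"
    if "q \<in> points M''" "U \<in> tangent_space M'' q" "V \<in> tangent_space M'' q" for q U V
    using isometry[OF that(1,2) tensor_field_1_1D(1)[OF P'' that(1,3)]] involution[OF that(1,3)] by simp
  \<comment> \<open>Items two to five are the hypotheses that
    \<open>decomposition_identities\<close> needs on \<open>M'\<close> for the second step; the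
    first identifies \<open>u2'\<close> for later use.\<close>
  have first: "u2' q Z = g' q Z (\<xi>2' q)"
      "Z' \<in> tangent_space M' q \<Longrightarrow> g' q (P' q Z) Z' = g' q Z (P' q Z')"
      "P' q (P' q Z) = Z - g' q Z (\<xi>2' q) *\<^sub>R \<xi>2' q"
      "P' q (\<xi>2' q) = - a22' q *\<^sub>R \<xi>2' q"
      "g' q (\<xi>2' q) (\<xi>2' q) = 1 - (a22' q)\<^sup>2"
    if q: "q \<in> points M'" and Z: "Z \<in> tangent_space M' q" for q Z Z'
  proof -
    note fq = H.fp[OF q]
    note zero = subspace_0[OF H.M_sub, of q] subspace_0[OF H.N_sub, of "f' q"]
    have df0: "H.df q 0 = 0" using H.df_scale[OF q zero(1), of 0] by simp
    have h0: "g'' (f' q) Z 0 = 0" if "Z \<in> tangent_space M'' (f' q)" for Z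
      using H.h_scale[OF q that zero(2), of 0] by simp
    have u2'_eq: "u2' q Z = g' q Z (\<xi>2' q)" if "Z \<in> tangent_space M' q" for Z
      by (rule H.decomposition_symmetric(1)[OF induced P'' q symmetric[OF fq] that])
    have zero_split: "0 = H.df q 0 + 0 *\<^sub>R N2 q" by (simp add: df0)
    have square: "P'' (f' q) (P'' (f' q) U) = U - g'' (f' q) U 0 *\<^sub>R 0"
      if "U \<in> tangent_space M'' (f' q)" for U
      using involution[OF fq that] by simp
    \<comment> \<open>The zero vector satisfies every eigenvector equation; the value 1 is chosen
      for the norm relation that follows.\<close>
    have zero_eigen: "P'' (f' q) 0 = - 1 *\<^sub>R 0"
      using linear_on_subspaceD(2)[OF tensor_field_1_1D(2)[OF P'' fq] zero(2), of 0] by simp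
    have norm_0: "g'' (f' q) 0 0 = 1 - (1::real)\<^sup>2" using h0[OF zero(2)] by simp
    note ids = H.decomposition_identities[OF induced P'' q symmetric[OF fq] square zero_eigen norm_0
        zero(1) zero_split]
    have ids: "u2' q (\<xi>2' q) = 1 - (a22' q)\<^sup>2 - 0\<^sup>2"
      "P' q (\<xi>2' q) = - a22' q *\<^sub>R \<xi>2' q - 0 *\<^sub>R 0"
      "P' q (P' q Z) = Z - u2' q Z *\<^sub>R \<xi>2' q - g' q Z 0 *\<^sub>R 0"
      by - (rule ids; (assumption | rule Z))+
    show "u2' q Z = g' q Z (\<xi>2' q)" by (rule u2'_eq[OF Z])
    show "g' q (P' q Z) Z' = g' q Z (P' q Z')" if "Z' \<in> tangent_space M' q"
      by (rule H.decomposition_symmetric(2)[OF induced P'' q symmetric[OF fq] Z that])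
    show "P' q (P' q Z) = Z - g' q Z (\<xi>2' q) *\<^sub>R \<xi>2' q" using ids(3) u2'_eq[OF Z] by simp
    show "P' q (\<xi>2' q) = - a22' q *\<^sub>R \<xi>2' q" using ids(2) by simp
    show "g' q (\<xi>2' q) (\<xi>2' q) = 1 - (a22' q)\<^sup>2"
      using ids(1) u2'_eq[OF vector_fieldsD[OF \<xi>2' q]] by simp
  qed
  show ?thesis
  proof (intro conjI allI impI ballI)
    let ?P = "\<lambda>p X. K.tangent_part p (P' (f p) (K.df p X))"
    let ?u1 = "\<lambda>p X. K.normal_part p (P' (f p) (K.df p X))"
    let ?\<xi>1 = "\<lambda>p. K.tangent_part p (P' (f p) (N1 p))"
    let ?\<xi>2T = "\<lambda>p. K.tangent_part p (\<xi>2' (f p))"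
    let ?a12 = "\<lambda>p. K.normal_part p (\<xi>2' (f p))"
    let ?a = "\<lambda>p. vector [vector [K.normal_part p (P' (f p) (N1 p)), ?a12 p],
      vector [?a12 p, a22' (f p)]] :: real^2^2"
    note decomposition = K.hypersurface_decomposition_exists[OF P']
    note \<xi>2'_parts = K.tangent_part_vector_field[OF K.restrict_vector_field[OF \<xi>2']]
    have a11: "smooth_fun M (\<lambda>p. K.normal_part p (P' (f p) (N1 p)))"
      using decomposition unfolding hypersurface_decomposition_def by blast
    have a: "smooth_fun M (\<lambda>p. ?a p $ \<alpha> $ \<beta>)" for \<alpha> \<beta>
      by (rule smooth_fun_2_2) (simp_all add: a11 \<xi>2'_parts(2) K.restrict_smooth_fun[OF a22'])
    \<comment> \<open>The witness is \<open>?a12 p *\<^sub>R N1 p\<close>. As \<open>f'\<close> is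
      isometric, its product with \<open>N1\<close> measured in \<open>M''\<close> is the product in
      \<open>M'\<close>, namely \<open>?a12 p\<close>.\<close>
    have \<zeta>: "\<exists>\<zeta>\<in>normal_space M M' g' f p. \<xi>2' (f p) = K.df p (?\<xi>2T p) + \<zeta> \<and>
        ?a p $ 1 $ 2 = g'' (f' (f p)) (H.df (f p) \<zeta>) (H.df (f p) (N1 p))" if p: "p \<in> points M" for p
    proof (intro bexI conjI)
      note fp = K.fp[OF p] and N1 = K.normal_in[OF p]
      have \<zeta>: "?a12 p *\<^sub>R N1 p \<in> tangent_space M' (f p)"
        using subspace_scale[OF H.M_sub N1] .
      show "?a12 p *\<^sub>R N1 p \<in> normal_space M M' g' f p"
        using K.h_scale[OF p K.df_in[OF p] N1] K.normal_orth[OF p] \<zeta> by (simp add: normal_space_def)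
      show "\<xi>2' (f p) = K.df p (?\<xi>2T p) + ?a12 p *\<^sub>R N1 p"
        using K.split_parts(2)[OF p vector_fieldsD[OF \<xi>2' fp]] by simp
      have "g'' (f' (f p)) (H.df (f p) (?a12 p *\<^sub>R N1 p)) (H.df (f p) (N1 p)) = g' (f p) (N1 p) (?a12 p *\<^sub>R N1 p)"
        using H.df_isometry[OF fp \<zeta> N1] K.h_sym[OF p N1 \<zeta>] by simp
      then show "?a p $ 1 $ 2 = g'' (f' (f p)) (H.df (f p) (?a12 p *\<^sub>R N1 p)) (H.df (f p) (N1 p))"
        by (simp add: K.h_scale[OF p N1 N1] K.normal_unit[OF p])
    qed
    have "induced_structure M M' g' M'' g'' f f' N1 P' u2' \<xi>2' a22'
        ?P ?u1 (\<lambda>p X. u2' (f p) (K.df p X)) ?\<xi>1 ?\<xi>2T ?a"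
      unfolding induced_structure_def
    proof (intro conjI allI ballI)
      show "hypersurface_decomposition M M' f N1 P' ?P ?u1 ?\<xi>1 (\<lambda>p. ?a p $ 1 $ 1)"
        using decomposition by simp
      show "one_form M (\<lambda>p X. u2' (f p) (K.df p X))" by (rule K.pullback_one_form[OF u2'])
    qed (simp_all only: \<xi>2'_parts(1) a \<zeta>, simp_all)
    then show "\<exists>P u1 u2 \<xi>1 \<xi>2T a.
        induced_structure M M' g' M'' g'' f f' N1 P' u2' \<xi>2' a22' P u1 u2 \<xi>1 \<xi>2T a" by blast
  next
    fix P u1 u2 \<xi>1 \<xi>2T a X Y p
    assume induced_M: "induced_structure M M' g' M'' g'' f f' N1 P' u2' \<xi>2' a22' P u1 u2 \<xi>1 \<xi>2T a"
      and "X \<in> vector_fields M" "Y \<in> vector_fields M" and p: "p \<in> points M"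
    then have X: "X p \<in> tangent_space M p" and Y: "Y p \<in> tangent_space M p"
      by (simp_all add: vector_fieldsD)
    note fp = K.fp[OF p] and N1 = K.normal_in[OF p]
    have decomposition: "hypersurface_decomposition M M' f N1 P' P u1 \<xi>1 (\<lambda>p. a p $ 1 $ 1)"
      and \<xi>2T: "\<xi>2T p \<in> tangent_space M p"
      and u2: "\<And>Z. Z \<in> tangent_space M p \<Longrightarrow> u2 p Z = u2' (f p) (K.df p Z)"
      and a: "a p $ 2 $ 2 = a22' (f p)" "a p $ 2 $ 1 = a p $ 1 $ 2"
      using induced_M p by (auto simp: induced_structure_def vector_fieldsD)
    obtain \<zeta> where \<zeta>: "\<zeta> \<in> tangent_space M' (f p)" "\<And>v. v \<in> tangent_space M p \<Longrightarrow> g' (f p) (K.df p v) \<zeta> = 0"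
      and \<xi>2'_eq: "\<xi>2' (f p) = K.df p (\<xi>2T p) + \<zeta>"
      and a12: "a p $ 1 $ 2 = g'' (f' (f p)) (H.df (f p) \<zeta>) (H.df (f p) (N1 p))"
      using induced_M p unfolding induced_structure_def normal_space_def by blast
    \<comment> \<open>A vector normal to \<open>M\<close> has a tangential part of length 0, so it
      is a multiple of \<open>N1\<close>. The isometry \<open>f'\<close> identifies the coefficient
      with the matrix entry.\<close>
    have \<zeta>_eq: "\<zeta> = a p $ 1 $ 2 *\<^sub>R N1 p"
    proof -
      obtain v r where v: "v \<in> tangent_space M p" "\<zeta> = K.df p v + r *\<^sub>R N1 p"
        using K.split_exists[OF p \<zeta>(1)] .
      have "g p v v = 0"
        using \<zeta>(2)[OF v(1)] K.inner_split_tangent[OF p v(1) v(1), of r] v(2) by simp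
      then have "v = 0" using riemannian_metricD(2)[OF K.g p v(1)] by fastforce
      moreover have "K.df p 0 = 0"
        using K.df_scale[OF p subspace_0[OF K.M_sub], of 0] by simp
      moreover have "r = a p $ 1 $ 2"
        using a12 H.df_isometry[OF fp \<zeta>(1) N1] K.h_sym[OF p N1 \<zeta>(1)] K.inner_split_normal[OF p v(1), of r] v(2)
        by simp
      ultimately show ?thesis using v(2) by simp
    qed
    \<comment> \<open>The normal part of \<open>\<xi>2'\<close> is orthogonal to the image of
      \<open>Z\<close> and drops out.\<close>
    have u2_eq: "u2 p Z = g p Z (\<xi>2T p)" if "Z \<in> tangent_space M p" for Z
      using first(1)[OF fp K.df_in[OF p that]] K.inner_split_tangent[OF p \<xi>2T that] u2[OF that]
      by (simp add: \<xi>2'_eq \<zeta>_eq)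
    \<comment> \<open>Here \<open>Q = P'\<close>, \<open>\<eta> = \<xi>2'\<close> and
      \<open>b = a22'\<close>, all at \<open>f p\<close>.\<close>
    note ids = K.decomposition_identities[OF decomposition P' p first(2)[OF fp] first(3)[OF fp]
        first(4)[OF fp N1] first(5)[OF fp N1] \<xi>2T \<xi>2'_eq[unfolded \<zeta>_eq]]
    note in_M = K.decomposition_in[OF decomposition P' p]
    \<comment> \<open>Rewriting each value of \<open>u2\<close> as a product with
      \<open>\<xi>2T\<close>, and the second row of the matrix, brings the goals into the form of
      \<open>ids\<close>.\<close>
    note u2_simps = u2_eq[OF X] u2_eq[OF Y] u2_eq[OF in_M(1)[OF X]] u2_eq[OF in_M(2)] u2_eq[OF \<xi>2T] a

    show "P p (P p (X p)) = X p - u1 p (X p) *\<^sub>R \<xi>1 p - u2 p (X p) *\<^sub>R \<xi>2T p"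
      "u1 p (P p (X p)) = - (a p $ 1 $ 1) * u1 p (X p) - a p $ 1 $ 2 * u2 p (X p)"
      "u2 p (P p (X p)) = - (a p $ 2 $ 1) * u1 p (X p) - a p $ 2 $ 2 * u2 p (X p)"
      "u1 p (\<xi>1 p) = 1 - (a p $ 1 $ 1)\<^sup>2 - (a p $ 1 $ 2)\<^sup>2"
      "u2 p (\<xi>1 p) = - (a p $ 1 $ 1) * a p $ 1 $ 2 - a p $ 1 $ 2 * a p $ 2 $ 2"
      "u1 p (\<xi>2T p) = - (a p $ 1 $ 1) * a p $ 1 $ 2 - a p $ 1 $ 2 * a p $ 2 $ 2"
      "u2 p (\<xi>2T p) = 1 - (a p $ 1 $ 2)\<^sup>2 - (a p $ 2 $ 2)\<^sup>2"
      "P p (\<xi>1 p) = - (a p $ 1 $ 1) *\<^sub>R \<xi>1 p - a p $ 1 $ 2 *\<^sub>R \<xi>2T p"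
      "P p (\<xi>2T p) = - (a p $ 1 $ 2) *\<^sub>R \<xi>1 p - a p $ 2 $ 2 *\<^sub>R \<xi>2T p"
      "g p (P p (X p)) (P p (Y p)) =
        g p (X p) (Y p) - u1 p (X p) * u1 p (Y p) - u2 p (X p) * u2 p (Y p)"
      unfolding u2_simps by - (rule ids; (assumption | rule X Y))+
    show "u2 p (X p) = g p (X p) (\<xi>2T p)" by (rule u2_eq[OF X])
    show "u1 p (X p) = g p (X p) (\<xi>1 p)" "g p (P p (X p)) (Y p) = g p (X p) (P p (Y p))"
      using K.decomposition_symmetric[OF decomposition P' p first(2)[OF fp]] X Y by blast+
  qed
qed

end
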